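(* Let $K$ be a polyhedral complex with a monotonic ordering $\sigma_0,\ldots,\sigma_m$ of its cells, and let $K^p = A_p \sqcup A^p \sqcup E_p$ be the associated tri-partition. Then for every dimension $p$: (1) $\{Z_p(\sigma_j) \mid \sigma_j \in A^p \sqcup E_p\}$ is a basis of the cycle group $Z_p(K)$; (2) the homology classes of $\{Z_p(\sigma_j) \mid \sigma_j \in E_p\}$ form a basis of $\tilde H_p(K)$; (3) $\{\partial \Gamma_p(\sigma_j) \mid \sigma_j \in A_p\}$ is a basis of the boundary group $B_{p-1}(K)$; (4) $\{Z^p(\sigma_i) \mid \sigma_i \in A_p \sqcup E_p\}$ is a basis of the cocycle group $Z^p(K)$; (5) the cohomology classes of $\{Z^p(\sigma_i) \mid \sigma_i \in E_p\}$ form a basis of $\tilde H^p(K)$; (6) $\{\delta \Gamma^p(\sigma_i) \mid \sigma_i \in A^p\}$ is a basis of the coboundary group $B^{p+1}(K)$.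
   Context: A polyhedral complex $K$ is a finite collection of convex polytopes (cells), closed under taking faces, any two intersecting in a common face, containing by convention the empty cell (dimension $-1$, a face of every cell); $K^p$ is its set of $p$-cells. Coefficients are $\mathbb{Z}/2\mathbb{Z}$: $p$-chains and $p$-cochains are subsets of $K^p$ with symmetric difference as sum; $\partial c$ is the set of $(p-1)$-cells that are faces of an odd number of cells of the $p$-chain $c$; $\delta c$ is the set of $(p+1)$-cells having an odd number of faces in the $p$-cochain $c$. $Z_p(K)$, $B_p(K)$ are the groups of $p$-cycles (empty boundary) and $p$-boundaries, $\tilde H_p(K)=Z_p(K)/B_p(K)$ (reduced homology, because of the empty cell); $Z^p(K)$, $B^p(K)$ are the groups of $p$-cocycles (empty coboundary) and $p$-coboundaries (coboundaries of $(p-1)$-cochains), $\tilde H^p(K)=Z^p(K)/B^p(K)$. Relative cohomology of $(K,L)$, $L$ a subcomplex, uses cochains, cocycles and coboundaries contained in $K\setminus L$. A monotonic ordering lists each cell after all its faces; $K_\ell=\{\sigma_0,\ldots,\sigma_\ell\}$. Boundary matrix: $\partial[i,j]=1$ iff $\sigma_i\subseteq\sigma_j$ and $\dim\sigma_i=\dim\sigma_j-1$. Exhaustive column reduction: start with $R=\partial$; with $\mathrm{low}(j)$ the row of the lowest non-zero entry of column $j$ of $R$ ($-\infty$ if zero), for $j=0,\ldots,m$, while some $\ell<j$ has $\mathrm{low}(\ell)>-\infty$ and $R[\mathrm{low}(\ell),j]\neq0$, add column $\ell$ to column $j$. Exhaustive row reduction: start with $Q=\partial$; with $\mathrm{left}(i)$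 the column of the leftmost non-zero entry of row $i$ of $Q$ ($\infty$ if zero), for $i=m,\ldots,0$, while some $\ell>i$ has $\mathrm{left}(\ell)<\infty$ and $Q[i,\mathrm{left}(\ell)]\neq0$, add row $\ell$ to row $i$. Tri-partition associated with the ordering: $A_p$ = $p$-cells whose column in the reduced $R$ is non-zero; $A^p$ = $p$-cells whose row in the reduced $Q$ is non-zero; $E_p=K^p\setminus A_p\setminus A^p$. Canonical objects: for $\sigma_j\in A^p\sqcup E_p$, $Z_p(\sigma_j)$ is the unique non-empty $p$-cycle contained in $A_p\sqcup\{\sigma_j\}$; for $\sigma_j\in A_p$, $\Gamma_p(\sigma_j)$ is the unique $p$-chain contained in $A_p$ whose boundary is the sum of canonical $(p-1)$-cycles that is rendered trivial (non-bounding in $K_{j-1}$, bounding in $K_j$) by adding $\sigma_j$ to $K_{j-1}$. Symmetrically, for $\sigma_i\in A_p\sqcup E_p$, $Z^p(\sigma_i)$ is the unique non-empty $p$-cocycle contained in $A^p\sqcup\{\sigma_i\}$; for $\sigma_i\in A^p$, $\Gamma^p(\sigma_i)$ is the unique $p$-cochain contained in $A^p$ whose coboundary is the sum of canonical $(p+1)$-cocycles rendered trivial in relative cohomology when passing from the pair $(K,K_i)$ to $(K,K_{i-1})$. *)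

theory Defs
  imports
    "HOL-Analysis.Analysis"
    "HOL-Algebra.Coset"
    "HOL-Algebra.FiniteProduct"
    "HOL-Library.Z2"
begin

section \<open>Polyhedral complexes\<close>

text \<open>
  The dimension of a cell is its affine dimension, so that the empty cell has dimension \<open>-1\<close>.
  The relation \<open>face_of\<close> admits both the empty set and the cell itself as faces.
\<close>

definition polyhedral_complex :: "'a::euclidean_space set set \<Rightarrow> bool" where
  "polyhedral_complex K \<longleftrightarrow>
     finite K \<and> {} \<in> K \<and>
     (\<forall>S\<in>K. polytope S) \<and>
     (\<forall>S\<in>K. \<forall>F. F face_of S \<longrightarrow> F \<in> K) \<and>
     (\<forall>S\<in>K. \<forall>T\<in>K. (S \<inter> T) face_of S \<and> (S \<inter> T) face_of T)"

definition cells :: "'a::euclidean_space set set \<Rightarrow> int \<Rightarrow> 'a set set" where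
  "cells K p = {S \<in> K. aff_dim S = p}"

text \<open>
  An ordering \<open>\<sigma>\<^sub>0, \<dots>, \<sigma>\<^sub>m\<close> is a list of length \<open>m + 1\<close>.  The
  subcomplex \<open>K\<^sub>\<ell>\<close> is \<open>set (take (Suc \<ell>) \<sigma>)\<close>, and its complement in the
  complex is \<open>set (drop (Suc \<ell>) \<sigma>)\<close>.
\<close>

definition monotonic_ordering :: "'a::euclidean_space set set \<Rightarrow> 'a set list \<Rightarrow> bool" where
  "monotonic_ordering K \<sigma> \<longleftrightarrow>
     distinct \<sigma> \<and> set \<sigma> = K \<and>
     (\<forall>i < length \<sigma>. \<forall>j < length \<sigma>. \<sigma> ! i face_of \<sigma> ! j \<longrightarrow> i \<le> j)"


section \<open>Bases of vector spaces over the two-element field\<close>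

text \<open>
  A vector space over the field with two elements is the same thing as an abelian group (written
  multiplicatively here) in which every element is its own inverse.  A linear combination of a
  family \<open>f\<close> is then the product of a finite subfamily.  Being a basis is a property of the family,
  not just of its range: independence forces \<open>f\<close> to be injective on \<open>I\<close>.
\<close>

definition z2_vector_space :: "('g, 'b) monoid_scheme \<Rightarrow> bool" where
  "z2_vector_space G \<longleftrightarrow>
     comm_group G \<and> (\<forall>x\<in>carrier G. x \<otimes>\<^bsub>G\<^esub> x = \<one>\<^bsub>G\<^esub>)"

definition z2_basis :: "('g, 'b) monoid_scheme \<Rightarrow> 'i set \<Rightarrow> ('i \<Rightarrow> 'g) \<Rightarrow> bool" where
  "z2_basis G I f \<longleftrightarrow>
     z2_vector_space G \<and> f ` I \<subseteq> carrier G \<and>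
     (\<forall>S\<subseteq>I. finite S \<longrightarrow> finprod G f S = \<one>\<^bsub>G\<^esub> \<longrightarrow> S = {}) \<and>
     (\<forall>x\<in>carrier G. \<exists>S\<subseteq>I. finite S \<and> x = finprod G f S)"


section \<open>Homology and cohomology modulo 2\<close>

text \<open>The same group serves for \<open>p\<close>-chains and for \<open>p\<close>-cochains.\<close>

definition chain_group :: "'a::euclidean_space set set \<Rightarrow> int \<Rightarrow> 'a set set monoid" where
  "chain_group K p = \<lparr>carrier = Pow (cells K p), monoid.mult = sym_diff, one = {}\<rparr>"

definition bdry :: "'a::euclidean_space set set \<Rightarrow> int \<Rightarrow> 'a set set \<Rightarrow> 'a set set" where
  "bdry K p c = {T \<in> cells K (p - 1). odd (card {S \<in> c. T face_of S})}"

definition cobdry :: "'a::euclidean_space set set \<Rightarrow> int \<Rightarrow> 'a set set \<Rightarrow> 'a set set" where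
  "cobdry K p c = {S \<in> cells K (p + 1). odd (card {T \<in> c. T face_of S})}"

definition cycles :: "'a::euclidean_space set set \<Rightarrow> int \<Rightarrow> 'a set set set" where
  "cycles K p = {c. c \<subseteq> cells K p \<and> bdry K p c = {}}"

definition boundaries :: "'a::euclidean_space set set \<Rightarrow> int \<Rightarrow> 'a set set set" where
  "boundaries K p = bdry K (p + 1) ` Pow (cells K (p + 1))"

text \<open>
  Cocycles and coboundaries of a pair \<open>(K, L)\<close>; the absolute ones are those of \<open>(K, {})\<close>.
  If \<open>L\<close> is a subcomplex, the coboundary in \<open>K\<close> of a cochain disjoint from \<open>L\<close> is disjoint
  from \<open>L\<close>.
\<close>

definition rel_cocycles ::
  "'a::euclidean_space set set \<Rightarrow> 'a set set \<Rightarrow> int \<Rightarrow> 'a set set set" where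
  "rel_cocycles K L p = {c. c \<subseteq> cells (K - L) p \<and> cobdry K p c = {}}"

definition rel_coboundaries ::
  "'a::euclidean_space set set \<Rightarrow> 'a set set \<Rightarrow> int \<Rightarrow> 'a set set set" where
  "rel_coboundaries K L p = cobdry K (p - 1) ` Pow (cells (K - L) (p - 1))"

abbreviation cocycles :: "'a::euclidean_space set set \<Rightarrow> int \<Rightarrow> 'a set set set" where
  "cocycles K p \<equiv> rel_cocycles K {} p"

abbreviation coboundaries :: "'a::euclidean_space set set \<Rightarrow> int \<Rightarrow> 'a set set set" where
  "coboundaries K p \<equiv> rel_coboundaries K {} p"

definition cycle_group :: "'a::euclidean_space set set \<Rightarrow> int \<Rightarrow> 'a set set monoid" where
  "cycle_group K p = (chain_group K p)\<lparr>carrier := cycles K p\<rparr>"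

definition boundary_group :: "'a::euclidean_space set set \<Rightarrow> int \<Rightarrow> 'a set set monoid" where
  "boundary_group K p = (chain_group K p)\<lparr>carrier := boundaries K p\<rparr>"

definition homology :: "'a::euclidean_space set set \<Rightarrow> int \<Rightarrow> 'a set set set monoid" where
  "homology K p = cycle_group K p Mod boundaries K p"

definition homology_class ::
  "'a::euclidean_space set set \<Rightarrow> int \<Rightarrow> 'a set set \<Rightarrow> 'a set set set" where
  "homology_class K p z = boundaries K p #>\<^bsub>cycle_group K p\<^esub> z"

definition cocycle_group :: "'a::euclidean_space set set \<Rightarrow> int \<Rightarrow> 'a set set monoid" where
  "cocycle_group K p = (chain_group K p)\<lparr>carrier := cocycles K p\<rparr>"

definition coboundary_group :: "'a::euclidean_space set set \<Rightarrow> int \<Rightarrow> 'a set set monoid" where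
  "coboundary_group K p = (chain_group K p)\<lparr>carrier := coboundaries K p\<rparr>"

definition cohomology :: "'a::euclidean_space set set \<Rightarrow> int \<Rightarrow> 'a set set set monoid" where
  "cohomology K p = cocycle_group K p Mod coboundaries K p"

definition cohomology_class ::
  "'a::euclidean_space set set \<Rightarrow> int \<Rightarrow> 'a set set \<Rightarrow> 'a set set set" where
  "cohomology_class K p z = coboundaries K p #>\<^bsub>cocycle_group K p\<^esub> z"


section \<open>Exhaustive matrix reduction\<close>

text \<open>
  An \<open>n \<times> n\<close> matrix is a function of which only the entries with both indices
  below \<open>n\<close> matter.
\<close>

type_synonym bit_matrix = "nat \<Rightarrow> nat \<Rightarrow> bit"

definition boundary_matrix :: "'a::euclidean_space set list \<Rightarrow> bit_matrix" where
  "boundary_matrix \<sigma> i j =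
     of_bool (i < length \<sigma> \<and> j < length \<sigma> \<and>
       \<sigma> ! i \<subseteq> \<sigma> ! j \<and> aff_dim (\<sigma> ! i) = aff_dim (\<sigma> ! j) - 1)"

text \<open>
  In \<open>low\<close> and \<open>left\<close>, the value \<open>None\<close> stands for \<open>-\<infinity>\<close> and \<open>\<infinity>\<close>, respectively.  Rows are
  numbered from top to bottom, so the lowest entry of a column has the largest row index.
\<close>

definition low :: "nat \<Rightarrow> bit_matrix \<Rightarrow> nat \<Rightarrow> nat option" where
  "low n R j =
     (if \<forall>i<n. R i j = 0 then None else Some (Max {i. i < n \<and> R i j \<noteq> 0}))"

definition left :: "nat \<Rightarrow> bit_matrix \<Rightarrow> nat \<Rightarrow> nat option" where
  "left n Q i =
     (if \<forall>j<n. Q i j = 0 then None else Some (Min {j. j < n \<and> Q i j \<noteq> 0}))"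

definition add_column :: "nat \<Rightarrow> nat \<Rightarrow> bit_matrix \<Rightarrow> bit_matrix" where
  "add_column l j R = (\<lambda>i k. if k = j then R i j + R i l else R i k)"

definition add_row :: "nat \<Rightarrow> nat \<Rightarrow> bit_matrix \<Rightarrow> bit_matrix" where
  "add_row l i Q = (\<lambda>k j. if k = i then Q i j + Q l j else Q k j)"

text \<open>
  One iteration of the inner while loops, which leave open which column or row is added.
\<close>

definition column_step :: "nat \<Rightarrow> nat \<Rightarrow> bit_matrix \<Rightarrow> bit_matrix \<Rightarrow> bool" where
  "column_step n j R R' \<longleftrightarrow>
     (\<exists>l<j. \<exists>i. low n R l = Some i \<and> R i j \<noteq> 0 \<and> R' = add_column l j R)"

definition row_step :: "nat \<Rightarrow> nat \<Rightarrow> bit_matrix \<Rightarrow> bit_matrix \<Rightarrow> bool" where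
  "row_step n i Q Q' \<longleftrightarrow>
     (\<exists>l. i < l \<and> l < n \<and>
        (\<exists>j. left n Q l = Some j \<and> Q i j \<noteq> 0 \<and> Q' = add_row l i Q))"

definition while_result :: "('s \<Rightarrow> 's \<Rightarrow> bool) \<Rightarrow> 's \<Rightarrow> 's \<Rightarrow> bool" where
  "while_result step x y \<longleftrightarrow> step\<^sup>*\<^sup>* x y \<and> (\<nexists>z. step y z)"

primrec for_result :: "('i \<Rightarrow> 's \<Rightarrow> 's \<Rightarrow> bool) \<Rightarrow> 'i list \<Rightarrow> 's \<Rightarrow> 's \<Rightarrow> bool" where
  "for_result step [] x y \<longleftrightarrow> y = x"
| "for_result step (i # is) x y \<longleftrightarrow>
     (\<exists>u. while_result (step i) x u \<and> for_result step is u y)"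

text \<open>
  Both algorithms terminate for all choices, with a result that does not depend on the choices.
\<close>

definition column_reduced :: "'a::euclidean_space set list \<Rightarrow> bit_matrix" where
  "column_reduced \<sigma> =
     (THE R. for_result (column_step (length \<sigma>)) [0..<length \<sigma>] (boundary_matrix \<sigma>) R)"

definition row_reduced :: "'a::euclidean_space set list \<Rightarrow> bit_matrix" where
  "row_reduced \<sigma> =
     (THE Q. for_result (row_step (length \<sigma>)) (rev [0..<length \<sigma>]) (boundary_matrix \<sigma>) Q)"


section \<open>Tri-partition and canonical objects\<close>

text \<open>
  The sets \<open>A\<^sub>p\<close>, \<open>A\<^sup>p\<close> and \<open>E\<^sub>p\<close> are \<open>tri_lower \<sigma> p\<close>, \<open>tri_upper \<sigma> p\<close> and
  \<open>tri_rest \<sigma> p\<close>.  They are also used for the lists \<open>take j \<sigma>\<close> and \<open>drop (Suc i) \<sigma>\<close>,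
  which yields the tri-partitions of the complex \<open>K\<^bsub>j-1\<^esub>\<close> and of the pair \<open>(K, K\<^sub>i)\<close>.
\<close>

definition tri_lower :: "'a::euclidean_space set list \<Rightarrow> int \<Rightarrow> 'a set set" where
  "tri_lower \<sigma> p =
     {\<sigma> ! j | j. j < length \<sigma> \<and> aff_dim (\<sigma> ! j) = p \<and>
        (\<exists>i < length \<sigma>. column_reduced \<sigma> i j \<noteq> 0)}"

definition tri_upper :: "'a::euclidean_space set list \<Rightarrow> int \<Rightarrow> 'a set set" where
  "tri_upper \<sigma> p =
     {\<sigma> ! i | i. i < length \<sigma> \<and> aff_dim (\<sigma> ! i) = p \<and>
        (\<exists>j < length \<sigma>. row_reduced \<sigma> i j \<noteq> 0)}"

definition tri_rest :: "'a::euclidean_space set list \<Rightarrow> int \<Rightarrow> 'a set set" where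
  "tri_rest \<sigma> p = cells (set \<sigma>) p - tri_lower \<sigma> p - tri_upper \<sigma> p"

definition canonical_cycle ::
  "'a::euclidean_space set list \<Rightarrow> int \<Rightarrow> 'a set \<Rightarrow> 'a set set" where
  "canonical_cycle \<sigma> p s =
     (THE z. z \<in> cycles (set \<sigma>) p \<and> z \<noteq> {} \<and> z \<subseteq> tri_lower \<sigma> p \<union> {s})"

definition canonical_cocycle ::
  "'a::euclidean_space set list \<Rightarrow> int \<Rightarrow> 'a set \<Rightarrow> 'a set set" where
  "canonical_cocycle \<sigma> p s =
     (THE z. z \<in> cocycles (set \<sigma>) p \<and> z \<noteq> {} \<and> z \<subseteq> tri_upper \<sigma> p \<union> {s})"

text \<open>
  In general, adding \<open>\<sigma>\<^sub>j\<close> to \<open>K\<^bsub>j-1\<^esub>\<close> renders several sums of canonical cycles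
  trivial.  The sum becomes unique when it ranges over the canonical cycles whose classes are a
  basis of the homology of \<open>K\<^bsub>j-1\<^esub>\<close>, namely those of the cells in the set \<open>E\<close> of
  \<open>K\<^bsub>j-1\<^esub>\<close>.  (The canonical cycles of such cells with respect to \<open>K\<^bsub>j-1\<^esub>\<close> and to \<open>K\<close>
  agree.)  Dually, the canonical cocycles are those of the cells in the set \<open>E\<close> of the pair
  \<open>(K, K\<^sub>i)\<close>.
\<close>

definition canonical_chain ::
  "'a::euclidean_space set list \<Rightarrow> int \<Rightarrow> nat \<Rightarrow> 'a set set" where
  "canonical_chain \<sigma> p j =
     (THE c. c \<subseteq> tri_lower \<sigma> p \<and>
        (\<exists>S \<subseteq> tri_rest (take j \<sigma>) (p - 1).
           bdry (set \<sigma>) p c =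
             finprod (chain_group (set \<sigma>) (p - 1)) (canonical_cycle \<sigma> (p - 1)) S) \<and>
        bdry (set \<sigma>) p c \<notin> boundaries (set (take j \<sigma>)) (p - 1) \<and>
        bdry (set \<sigma>) p c \<in> boundaries (set (take (Suc j) \<sigma>)) (p - 1))"

definition canonical_cochain ::
  "'a::euclidean_space set list \<Rightarrow> int \<Rightarrow> nat \<Rightarrow> 'a set set" where
  "canonical_cochain \<sigma> p i =
     (THE c. c \<subseteq> tri_upper \<sigma> p \<and>
        (\<exists>S \<subseteq> tri_rest (drop (Suc i) \<sigma>) (p + 1).
           cobdry (set \<sigma>) p c =
             finprod (chain_group (set \<sigma>) (p + 1)) (canonical_cocycle \<sigma> (p + 1)) S) \<and>
        cobdry (set \<sigma>) p c \<notin> rel_coboundaries (set \<sigma>) (set (take (Suc i) \<sigma>)) (p + 1) \<and>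
        cobdry (set \<sigma>) p c \<in> rel_coboundaries (set \<sigma>) (set (take i \<sigma>)) (p + 1))"

end

theory Submission
  imports Defs
begin

text \<open>
  Exhaustive reduction makes \<open>A\<^sub>p\<close> the set of cells whose column in the boundary matrix is not a sum
  of earlier columns, and \<open>A\<^sup>p\<close> the set of cells whose row is not a sum of later rows.  Hence the
  columns of \<open>A\<^sub>p\<close> are a basis of the column space, which gives a unique cycle in
  \<open>A\<^sub>p \<union> {\<sigma>\<^sub>j}\<close> for every other cell \<open>\<sigma>\<^sub>j\<close>, and these cycles form a basis of the cycle
  group.  The rows of \<open>A\<^sup>p\<close> are a basis of the row space, so intersecting with \<open>A\<^sup>p\<close> is an
  isomorphism from the \<open>p\<close>-boundaries to the subsets of \<open>A\<^sup>p\<close>; a cycle is therefore homologous to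
  exactly one cycle in \<open>A\<^sub>p \<union> E\<^sub>p\<close>.  Applied to \<open>K\<^bsub>j-1\<^esub>\<close>, this yields existence and uniqueness of
  \<open>\<Gamma>\<^sub>p(\<sigma>\<^sub>j)\<close>, whose boundary is new in \<open>K\<^sub>j\<close>, so that these boundaries form a basis by
  triangularity.  Cohomology is the same statement for the reversed ordering and the transposed matrix.
  That boundaries are cycles rests on the fact that a face of codimension two of a polytope lies in
  exactly two facets.
\<close>

section \<open>Sums of sets modulo 2\<close>

text \<open>The algorithms enter through one fact only: a reduced column is non-zero iff the
  original column is not a sum of earlier original columns. This no longer mentions the pivots or
  the free choices of the loops. \<open>A\<^sub>p\<close> and \<open>A\<^sup>p\<close> come from two
  unrelated reductions; that they are disjoint is a property of complexes, not of matrices, and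
  rests on the boundary of a boundary being empty. The obstacle for \<Gamma> is that the two sets
  behave differently under truncation. Membership in \<open>A\<^sub>p\<close> depends on earlier
  columns only, so \<open>A\<^sub>p\<close> and the canonical cycles are inherited by every prefix
  of the ordering. Membership in \<open>A\<^sup>p\<close> depends on later cells, so
  \<open>E\<^sub>p\<close> has to be recomputed for each prefix, and each prefix must be treated as
  a complex in its own right. Dually this is required of suffixes, which are not subcomplexes. The
  argument is therefore carried out for lists with an abstract incidence relation, a class closed
  under prefixes, suffixes and reversal; polytopes are needed only to verify its axioms.\<close>

definition xsum :: "('i \<Rightarrow> 'c set) \<Rightarrow> 'i set \<Rightarrow> 'c set" where
  "xsum f S = {x. odd (card {s \<in> S. x \<in> f s})}"

lemma odd_card_sym_diff:
  assumes "finite A" "finite B"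
  shows "odd (card (sym_diff A B)) \<longleftrightarrow> odd (card A) \<noteq> odd (card B)"
proof -
  have "card (sym_diff A B) = card (A - B) + card (B - A)"
    using assms by (intro card_Un_disjoint) auto
  moreover have "card A = card (A - B) + card (A \<inter> B)" "card B = card (B - A) + card (A \<inter> B)"
    using assms by (metis Int_commute add.commute card_Int_Diff)+
  ultimately show ?thesis by presburger
qed

text \<open>The parity of \<open>A \<inter> y\<close> serves as the pairing of two vectors over the
  two-element field; this is its additivity.\<close>

lemma odd_card_Int_sym_diff:
  assumes "finite y"
  shows "odd (card (sym_diff A B \<inter> y)) \<longleftrightarrow> odd (card (A \<inter> y)) \<noteq> odd (card (B \<inter> y))"
proof -
  have "sym_diff A B \<inter> y = sym_diff (A \<inter> y) (B \<inter> y)" by blast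
  then show ?thesis using odd_card_sym_diff assms by (metis finite_Int)
qed

lemma xsum_empty [simp]: "xsum f {} = {}"
  by (simp add: xsum_def)

lemma xsum_sym_diff:
  assumes "finite S" "finite T"
  shows "xsum f (sym_diff S T) = sym_diff (xsum f S) (xsum f T)"
proof -
  have "{s \<in> sym_diff S T. x \<in> f s} = sym_diff {s \<in> S. x \<in> f s} {s \<in> T. x \<in> f s}" for x by blast
  then have "odd (card {s \<in> sym_diff S T. x \<in> f s}) \<longleftrightarrow>
      odd (card {s \<in> S. x \<in> f s}) \<noteq> odd (card {s \<in> T. x \<in> f s})" for x
    using odd_card_sym_diff[of "{s \<in> S. x \<in> f s}" "{s \<in> T. x \<in> f s}"] assms by simp
  then show ?thesis unfolding xsum_def by blast
qed

lemma xsum_singleton [simp]: "xsum f {a} = f a"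
proof -
  have "{s. s = a \<and> x \<in> f s} = (if x \<in> f a then {a} else {})" for x by auto
  then show ?thesis by (simp add: xsum_def)
qed

lemma xsum_insert:
  assumes "finite S" "a \<notin> S"
  shows "xsum f (insert a S) = sym_diff (f a) (xsum f S)"
  using xsum_sym_diff[of "{a}" S f] assms by simp

lemma xsum_cong: "(\<And>s. s \<in> S \<Longrightarrow> f s = g s) \<Longrightarrow> xsum f S = xsum g S"
  unfolding xsum_def by (metis (mono_tags, lifting) Collect_cong)

lemma xsum_subset: "(\<And>s. s \<in> S \<Longrightarrow> f s \<subseteq> X) \<Longrightarrow> xsum f S \<subseteq> X"
proof (rule subsetI)
  fix x assume *: "\<And>s. s \<in> S \<Longrightarrow> f s \<subseteq> X" "x \<in> xsum f S"
  then have "{s \<in> S. x \<in> f s} \<noteq> {}" unfolding xsum_def by (metis (mono_tags) card.empty even_zero mem_Collect_eq)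
  with * show "x \<in> X" by blast
qed

lemma xsum_Int: "xsum (\<lambda>s. f s \<inter> Y) S = xsum f S \<inter> Y"
proof (rule Set.set_eqI)
  fix x
  have "{s \<in> S. x \<in> f s \<inter> Y} = (if x \<in> Y then {s \<in> S. x \<in> f s} else {})" by auto
  then show "x \<in> xsum (\<lambda>s. f s \<inter> Y) S \<longleftrightarrow> x \<in> xsum f S \<inter> Y" by (simp add: xsum_def)
qed

lemma xsum_singletons [simp]: "xsum (\<lambda>s. {s}) S = S"
proof -
  have "{s \<in> S. x = s} = (if x \<in> S then {x} else {})" for x by auto
  then show ?thesis by (auto simp: xsum_def)
qed

text \<open>\<open>xsum g\<close> is linear in its index set, so a sum of sums can be taken
  generator by generator. With \<open>facets\<close> for both maps, this reduces the double boundary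
  of a chain to single cells.\<close>

lemma xsum_xsum:
  assumes "finite S" "\<And>s. s \<in> S \<Longrightarrow> finite (f s)"
  shows "xsum g (xsum f S) = xsum (\<lambda>s. xsum g (f s)) S"
  using assms
proof (induction S rule: finite_induct)
  case (insert a S)
  have "finite (xsum f S)"
    by (rule finite_subset[OF xsum_subset[of S f "\<Union>(f ` S)"]]) (use insert in auto)
  then show ?case using insert by (simp add: xsum_insert xsum_sym_diff)
qed simp

lemma xsum_image:
  assumes "inj_on h S"
  shows "xsum f (h ` S) = xsum (\<lambda>s. f (h s)) S"
proof -
  have "card {t \<in> h ` S. x \<in> f t} = card {s \<in> S. x \<in> f (h s)}" for x
  proof -
    have "{t \<in> h ` S. x \<in> f t} = h ` {s \<in> S. x \<in> f (h s)}" by auto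
    then show ?thesis using assms by (metis (no_types, lifting) card_image inj_on_subset mem_Collect_eq subsetI)
  qed
  then show ?thesis by (simp add: xsum_def)
qed

text \<open>Injectivity on a common superset \<open>X\<close> of all terms ensures that the same
  elements cancel before and after applying \<open>h\<close>.\<close>

lemma image_xsum:
  assumes "inj_on h X" "\<And>s. s \<in> S \<Longrightarrow> f s \<subseteq> X" "finite S"
  shows "h ` xsum f S = xsum (\<lambda>s. h ` f s) S"
  using assms(3,2)
proof (induction S rule: finite_induct)
  case (insert a S)
  have "f a \<subseteq> X" "xsum f S \<subseteq> X" using insert by (auto intro!: xsum_subset)
  then have "h ` sym_diff (f a) (xsum f S) = sym_diff (h ` f a) (h ` xsum f S)"
    using inj_on_image_set_diff[OF assms(1)] by (simp add: image_Un)
      (metis Diff_subset dual_order.trans inj_on_image_set_diff[OF assms(1)])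
  then show ?case using insert by (simp add: xsum_insert)
qed simp

text \<open>Linearity of the parity pairing over whole sums; the adjointness of boundary and
  coboundary is an instance.\<close>

lemma odd_card_xsum_Int:
  assumes "finite S" "finite y"
  shows "odd (card (xsum f S \<inter> y)) \<longleftrightarrow> odd (card {s \<in> S. odd (card (f s \<inter> y))})"
  using assms(1)
proof (induction S rule: finite_induct)
  case (insert a S)
  have "{s \<in> insert a S. odd (card (f s \<inter> y))} =
     (if odd (card (f a \<inter> y)) then insert a else id) {s \<in> S. odd (card (f s \<inter> y))}"
    by auto
  with insert show ?case by (simp add: xsum_insert odd_card_Int_sym_diff[OF assms(2)])
qed simp

text \<open>A vector outside a finite span is detected by a linear functional, represented as
  pairing with a finite set \<open>y\<close>. In the induction, a functional \<open>y\<close> for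
  \<open>F\<close> may fail on \<open>f x\<close>. As \<open>v + f x\<close> lies outside the span
  of \<open>F\<close> too, it has a functional \<open>z\<close> of its own, and one of
  \<open>z\<close> and \<open>y + z\<close> vanishes on \<open>f x\<close> while still detecting
  \<open>v\<close>.\<close>

lemma xsum_separation:
  assumes "finite X" "v \<notin> xsum f ` Pow X" "finite v" "\<And>x. x \<in> X \<Longrightarrow> finite (f x)"
  shows "\<exists>y. finite y \<and> odd (card (v \<inter> y)) \<and> (\<forall>x\<in>X. even (card (f x \<inter> y)))"
  using assms
proof (induction X arbitrary: v rule: finite_induct)
  case empty
  then obtain a where "a \<in> v" by (auto simp: image_def)
  then have "v \<inter> {a} = {a}" by blast
  then have "finite {a} \<and> odd (card (v \<inter> {a}))" by simp
  then show ?case by blast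
next
  case (insert x F)
  have "v \<notin> xsum f ` Pow F" using insert.prems(1) by blast
  then obtain y where y: "finite y" "odd (card (v \<inter> y))" "\<forall>t\<in>F. even (card (f t \<inter> y))"
    using insert by (metis insertCI)
  show ?case
  proof (cases "even (card (f x \<inter> y))")
    case True
    with y show ?thesis by blast
  next
    case False
    have "sym_diff v (f x) \<notin> xsum f ` Pow F"
    proof
      assume "sym_diff v (f x) \<in> xsum f ` Pow F"
      then obtain S where S: "S \<subseteq> F" "sym_diff v (f x) = xsum f S" by blast
      have "finite S" "x \<notin> S" using S insert.hyps finite_subset by auto
      then have "xsum f (insert x S) = v" using S(2) by (simp add: xsum_insert) blast
      then show False using insert.prems(1) S(1) by (metis PowI imageI insert_mono)
    qed
    then obtain z where z: "finite z" "odd (card (sym_diff v (f x) \<inter> z))"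
        "\<forall>t\<in>F. even (card (f t \<inter> z))"
      using insert.IH[of "sym_diff v (f x)"] insert.prems by auto
    have zz: "odd (card (v \<inter> z)) \<noteq> odd (card (f x \<inter> z))"
      using z odd_card_Int_sym_diff by blast
    have yz: "odd (card (A \<inter> sym_diff y z)) \<longleftrightarrow> odd (card (A \<inter> y)) \<noteq> odd (card (A \<inter> z))"
      if "finite A" for A
      using odd_card_Int_sym_diff[OF that, of y z] by (simp add: Int_commute)
    show ?thesis
    proof (cases "even (card (f x \<inter> z))")
      case True
      with zz z show ?thesis by blast
    next
      case f: False
      with zz have "even (card (v \<inter> z))" by blast
      then have "odd (card (v \<inter> sym_diff y z))" using yz[of v] y insert.prems(2) by blast
      moreover have "even (card (f t \<inter> sym_diff y z))" if "t \<in> insert x F" for t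
        using that yz[of "f t"] insert.prems(3) f False y z by blast
      ultimately show ?thesis using y z by (metis finite_Diff finite_UnI)
    qed
  qed
qed

definition z2_subspace :: "'c set set \<Rightarrow> bool" where
  "z2_subspace C \<longleftrightarrow> {} \<in> C \<and> (\<forall>a\<in>C. \<forall>b\<in>C. sym_diff a b \<in> C)"

lemma z2_subspace_xsum:
  assumes "z2_subspace C" "finite S" "f ` S \<subseteq> C"
  shows "xsum f S \<in> C"
  using assms(2,3)
  by (induction S rule: finite_induct) (use assms(1) in \<open>auto simp: z2_subspace_def xsum_insert\<close>)

lemma z2_subspace_xsum_image:
  assumes "finite X"
  shows "z2_subspace (xsum f ` Pow X)"
  unfolding z2_subspace_def
proof (intro conjI ballI)
  show "{} \<in> xsum f ` Pow X" by (metis Pow_bottom imageI xsum_empty)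
next
  fix a b assume "a \<in> xsum f ` Pow X" "b \<in> xsum f ` Pow X"
  then obtain S T where "S \<subseteq> X" "T \<subseteq> X" "a = xsum f S" "b = xsum f T" by auto
  moreover from this have "finite S" "finite T" using assms finite_subset by auto
  ultimately have "sym_diff a b = xsum f (sym_diff S T)" "sym_diff S T \<subseteq> X"
    by (auto simp: xsum_sym_diff)
  then show "sym_diff a b \<in> xsum f ` Pow X" by blast
qed

section \<open>Groups of sets under symmetric difference, their bases and quotients\<close>

definition z2_group :: "'c set set \<Rightarrow> 'c set monoid" where
  "z2_group C = \<lparr>carrier = C, monoid.mult = sym_diff, one = {}\<rparr>"

lemma comm_group_z2_group:
  assumes "z2_subspace C"
  shows "comm_group (z2_group C)"
proof (rule comm_groupI)
  fix x y z assume "x \<in> carrier (z2_group C)" "y \<in> carrier (z2_group C)" "z \<in> carrier (z2_group C)"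
  show "x \<otimes>\<^bsub>z2_group C\<^esub> y \<otimes>\<^bsub>z2_group C\<^esub> z = x \<otimes>\<^bsub>z2_group C\<^esub> (y \<otimes>\<^bsub>z2_group C\<^esub> z)"
    by (simp add: z2_group_def) blast
qed (use assms in \<open>auto simp: z2_group_def z2_subspace_def\<close>)

lemma z2_vector_space_z2_group: "z2_subspace C \<Longrightarrow> z2_vector_space (z2_group C)"
  unfolding z2_vector_space_def using comm_group_z2_group by (auto simp: z2_group_def)

lemma finprod_z2_group:
  assumes "z2_subspace C" "finite S" "f ` S \<subseteq> C"
  shows "finprod (z2_group C) f S = xsum f S"
proof -
  interpret comm_group "z2_group C" using assms(1) by (rule comm_group_z2_group)
  show ?thesis using assms(2,3)
  proof (induction S rule: finite_induct)
    case (insert a S)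
    then show ?case
      by (subst finprod_insert) (auto simp: z2_group_def xsum_insert)
  qed (use finprod_empty in \<open>simp add: z2_group_def\<close>)
qed

lemma z2_basis_z2_group:
  assumes C: "z2_subspace C" and f: "f ` I \<subseteq> C"
    and indep: "\<And>S. \<lbrakk>S \<subseteq> I; finite S; xsum f S = {}\<rbrakk> \<Longrightarrow> S = {}"
    and span: "\<And>x. x \<in> C \<Longrightarrow> \<exists>S\<subseteq>I. finite S \<and> x = xsum f S"
  shows "z2_basis (z2_group C) I f"
proof -
  have *: "finprod (z2_group C) f S = xsum f S" if "S \<subseteq> I" "finite S" for S
    by (rule finprod_z2_group) (use that C f in auto)
  have carr: "carrier (z2_group C) = C" and one: "\<one>\<^bsub>z2_group C\<^esub> = {}" by (simp_all add: z2_group_def)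
  show ?thesis unfolding z2_basis_def carr one
    using z2_vector_space_z2_group[OF C] f indep span * by metis
qed

lemma r_coset_z2_group: "B #>\<^bsub>z2_group C\<^esub> a = (\<lambda>b. sym_diff b a) ` B"
  by (auto simp: r_coset_def z2_group_def)

text \<open>Everything is pulled back along the quotient map: a product of cosets is the coset of
  the \<open>xsum\<close>, and two cosets agree iff their representatives differ by an element of
  \<open>B\<close>.\<close>

lemma z2_basis_quotient:
  assumes C: "z2_subspace C" and B: "z2_subspace B" "B \<subseteq> C" and f: "f ` I \<subseteq> C"
    and indep: "\<And>S. \<lbrakk>S \<subseteq> I; finite S; xsum f S \<in> B\<rbrakk> \<Longrightarrow> S = {}"
    and span: "\<And>x. x \<in> C \<Longrightarrow> \<exists>S\<subseteq>I. finite S \<and> sym_diff x (xsum f S) \<in> B"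
  shows "z2_basis (z2_group C Mod B) I (\<lambda>s. B #>\<^bsub>z2_group C\<^esub> f s)"
proof -
  let ?G = "z2_group C" let ?q = "\<lambda>a. B #>\<^bsub>?G\<^esub> a"
  interpret G: comm_group ?G using C by (rule comm_group_z2_group)
  have inv: "inv\<^bsub>?G\<^esub> x = x" if "x \<in> C" for x
    using that by (intro G.inv_equality) (auto simp: z2_group_def)
  have subg: "subgroup B ?G"
    by (rule G.subgroupI) (use B inv in \<open>auto simp: z2_subspace_def z2_group_def\<close>)
  interpret N: normal B ?G using subg by (rule G.subgroup_imp_normal)
  interpret Q: comm_group "?G Mod B" using subg by (rule G.abelian_FactGroup)
  have carr: "carrier ?G = C" by (simp add: z2_group_def)
  have mult: "?q a \<otimes>\<^bsub>?G Mod B\<^esub> ?q b = ?q (sym_diff a b)" if "a \<in> C" "b \<in> C" for a b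
    using N.rcos_sum[of a b] that by (simp add: carr) (simp add: z2_group_def)
  have eq: "?q a = ?q b \<longleftrightarrow> sym_diff a b \<in> B" if "a \<in> C" "b \<in> C" for a b
  proof
    assume "?q a = ?q b"
    then have "a \<in> ?q b" using G.rcos_self[OF _ subg] that carr by metis
    then obtain c where "c \<in> B" "a = sym_diff c b" unfolding r_coset_z2_group by blast
    moreover from this have "sym_diff a b = c" by blast
    ultimately show "sym_diff a b \<in> B" by simp
  next
    assume *: "sym_diff a b \<in> B"
    have "a = sym_diff (sym_diff a b) b" by blast
    then have "a \<in> ?q b" unfolding r_coset_z2_group using * by (rule image_eqI)
    then show "?q a = ?q b" using G.repr_independence[OF _ _ subg] that carr by metis
  qed
  have emp: "{} \<in> C" using C by (simp add: z2_subspace_def)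
  have q0: "?q {} = B" by (simp add: r_coset_z2_group)
  have finp: "finprod (?G Mod B) (\<lambda>s. ?q (f s)) S = ?q (xsum f S)" if "finite S" "S \<subseteq> I" for S
    using that
  proof (induction S rule: finite_induct)
    case empty
    then show ?case using q0 by simp
  next
    case (insert a S)
    have "f a \<in> C" "xsum f S \<in> C" using insert f z2_subspace_xsum[OF C, of S f] by auto
    moreover have "(\<lambda>s. ?q (f s)) \<in> insert a S \<rightarrow> carrier (?G Mod B)"
      using insert.prems f by (auto simp: carrier_FactGroup carr intro!: imageI)
    ultimately show ?case using insert
      by (subst Q.finprod_insert) (auto simp: mult xsum_insert simp del: mult_FactGroup)
  qed
  have "x \<otimes>\<^bsub>?G Mod B\<^esub> x = \<one>\<^bsub>?G Mod B\<^esub>" if "x \<in> carrier (?G Mod B)" for x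
    using that mult q0 by (auto simp: carrier_FactGroup carr simp del: mult_FactGroup)
  then have "z2_vector_space (?G Mod B)"
    unfolding z2_vector_space_def using Q.comm_group_axioms by blast
  moreover have "(\<lambda>s. ?q (f s)) ` I \<subseteq> carrier (?G Mod B)"
    using f by (auto simp: carrier_FactGroup carr)
  moreover have "S = {}" if "S \<subseteq> I" "finite S" "finprod (?G Mod B) (\<lambda>s. ?q (f s)) S = \<one>\<^bsub>?G Mod B\<^esub>" for S
  proof -
    have "xsum f S \<in> C" using that f z2_subspace_xsum[OF C, of S f] by auto
    moreover have "?q (xsum f S) = ?q {}" using that finp q0 by simp
    ultimately have "xsum f S \<in> B" using eq[OF _ emp] by simp
    then show ?thesis using indep that by blast
  qed
  moreover have "\<exists>S\<subseteq>I. finite S \<and> x = finprod (?G Mod B) (\<lambda>s. ?q (f s)) S"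
    if "x \<in> carrier (?G Mod B)" for x
  proof -
    obtain a where a: "a \<in> C" "x = ?q a" using \<open>x \<in> carrier (?G Mod B)\<close> by (auto simp: carrier_FactGroup carr)
    then obtain S where S: "S \<subseteq> I" "finite S" "sym_diff a (xsum f S) \<in> B" using span by blast
    have "xsum f S \<in> C" using S f z2_subspace_xsum[OF C, of S f] by auto
    then show ?thesis using S a eq finp by metis
  qed
  ultimately show ?thesis unfolding z2_basis_def by blast
qed

section \<open>Spans and cosets of subspaces\<close>

definition z2_span :: "('i \<Rightarrow> 'c set) \<Rightarrow> 'i set \<Rightarrow> 'c set set" where
  "z2_span f X = xsum f ` Pow X"

lemma z2_span_memI: "S \<subseteq> X \<Longrightarrow> xsum f S \<in> z2_span f X"
  by (auto simp: z2_span_def)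

lemma z2_subspace_span: "finite X \<Longrightarrow> z2_subspace (z2_span f X)"
  unfolding z2_span_def by (rule z2_subspace_xsum_image)

lemma z2_span_base: "x \<in> X \<Longrightarrow> f x \<in> z2_span f X"
  using z2_span_memI[of "{x}" X f] by simp

lemma z2_span_cong: "(\<And>x. x \<in> X \<Longrightarrow> f x = g x) \<Longrightarrow> z2_span f X = z2_span g X"
  unfolding z2_span_def by (rule image_cong[OF refl], rule xsum_cong) auto

lemma z2_span_insert:
  assumes "finite X" "a \<notin> X"
  shows "z2_span f (insert a X) = z2_span f X \<union> sym_diff (f a) ` z2_span f X"
proof -
  have *: "xsum f (insert a S) = sym_diff (f a) (xsum f S)" if "S \<in> Pow X" for S
    using that assms by (metis PowD finite_subset subsetD xsum_insert)
  have "xsum f ` insert a ` Pow X = sym_diff (f a) ` xsum f ` Pow X"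
    unfolding image_image using * by (rule image_cong[OF refl])
  then show ?thesis by (simp add: z2_span_def Pow_insert image_Un)
qed

text \<open>With \<open>B\<close> the span of the earlier vectors, this shows that replacing the
  next vector by its reduced form leaves the enlarged span unchanged.\<close>

lemma z2_subspace_translate_eq:
  assumes "z2_subspace B" "sym_diff v w \<in> B"
  shows "sym_diff v ` B = sym_diff w ` B"
proof -
  have *: "sym_diff v ` B \<subseteq> sym_diff w ` B" if "sym_diff v w \<in> B" for v w
  proof (rule image_subsetI)
    fix b assume "b \<in> B"
    then have "sym_diff (sym_diff v w) b \<in> B" using that assms(1) by (simp add: z2_subspace_def)
    moreover have "sym_diff v b = sym_diff w (sym_diff (sym_diff v w) b)" by blast
    ultimately show "sym_diff v b \<in> sym_diff w ` B" by (rule image_eqI[rotated])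
  qed
  have "sym_diff w v \<in> B" using assms(2) by (simp add: Un_commute)
  then show ?thesis by (intro subset_antisym *[OF assms(2)] *)
qed

lemma z2_subspace_sym_diff_iff:
  assumes "z2_subspace B" "b \<in> B"
  shows "sym_diff a b \<in> B \<longleftrightarrow> a \<in> B"
proof -
  have "sym_diff (sym_diff a b) b = a" by blast
  then show ?thesis using assms unfolding z2_subspace_def by metis
qed

text \<open>The digit \<open>i\<close> is cancelled, and the remaining digits of \<open>w\<close>
  all have lower rank, so that together they stay below \<open>2 ^ r i\<close>.\<close>

lemma sum_power2_sym_diff_less:
  assumes "finite v" "finite w" "inj_on r w" "i \<in> v" "i \<in> w" "\<And>k. k \<in> w \<Longrightarrow> r k \<le> r i"
  shows "(\<Sum>k\<in>sym_diff v w. 2 ^ r k) < (\<Sum>k\<in>v. (2::nat) ^ r k)"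
proof -
  have "(\<Sum>k\<in>w - v. (2::nat) ^ r k) \<le> (\<Sum>k\<in>w - {i}. 2 ^ r k)"
    using assms by (intro sum_mono2) auto
  also have "\<dots> = (\<Sum>m\<in>r ` (w - {i}). 2 ^ m)"
    using assms(3) by (subst sum.reindex) (auto intro: inj_on_subset)
  also have "\<dots> \<le> (\<Sum>m<r i. 2 ^ m)"
  proof (rule sum_mono2)
    show "r ` (w - {i}) \<subseteq> {..<r i}"
      using assms(3,5,6) by (force simp: inj_on_def order.strict_iff_order)
  qed auto
  also have "\<dots> < 2 ^ r i" by (simp add: sum_power2 lessThan_atLeast0)
  also have "\<dots> \<le> (\<Sum>k\<in>v \<inter> w. 2 ^ r k)"
    using assms by (intro member_le_sum) auto
  finally have "(\<Sum>k\<in>w - v. (2::nat) ^ r k) < (\<Sum>k\<in>v \<inter> w. 2 ^ r k)" .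
  moreover have "(\<Sum>k\<in>sym_diff v w. (2::nat) ^ r k) = (\<Sum>k\<in>v - w. 2 ^ r k) + (\<Sum>k\<in>w - v. 2 ^ r k)"
    using assms by (intro sum.union_disjoint) auto
  moreover have "(\<Sum>k\<in>v. (2::nat) ^ r k) = (\<Sum>k\<in>v \<inter> w. 2 ^ r k) + (\<Sum>k\<in>v - w. 2 ^ r k)"
    using assms(1) by (rule sum.Int_Diff)
  ultimately show ?thesis by simp
qed

section \<open>Exhaustive reduction of a family of vectors\<close>

text \<open>
  Columns and rows are represented by their supports, and \<open>vec R j\<close> is the \<open>j\<close>-th one of the
  matrix \<open>R\<close>.  Row reduction fits by processing the list \<open>js\<close> backwards and reversing \<open>rank\<close>.
\<close>

locale reduction =
  fixes n :: nat and js :: "nat list" and before :: "nat \<Rightarrow> nat set"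
    and rank :: "nat \<Rightarrow> nat" and pivot :: "nat set \<Rightarrow> nat option"
    and vec :: "'s \<Rightarrow> nat \<Rightarrow> nat set" and step :: "nat \<Rightarrow> 's \<Rightarrow> 's \<Rightarrow> bool"
  assumes distinct: "distinct js"
    and before: "js = pre @ j # post \<Longrightarrow> before j = set pre"
    and inj_rank: "inj_on rank {..<n}"
    and pivot_None: "v \<subseteq> {..<n} \<Longrightarrow> pivot v = None \<longleftrightarrow> v = {}"
    and pivot_Some: "\<lbrakk>v \<subseteq> {..<n}; pivot v = Some i\<rbrakk> \<Longrightarrow> i \<in> v \<and> (\<forall>k\<in>v. rank k \<le> rank i)"
    and bij_vec: "bij vec"
    and step_iff: "j \<in> set js \<Longrightarrow> step j R R' \<longleftrightarrow>
      (\<exists>l\<in>before j. \<exists>i. pivot (vec R l) = Some i \<and> i \<in> vec R j \<and>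
         vec R' = (vec R)(j := sym_diff (vec R j) (vec R l)))"
begin

definition bounded :: "'s \<Rightarrow> bool" where
  "bounded R \<longleftrightarrow> (\<forall>l. vec R l \<subseteq> {..<n})"

definition distinct_pivots :: "nat set \<Rightarrow> 's \<Rightarrow> bool" where
  "distinct_pivots P R \<longleftrightarrow>
     (\<forall>l\<in>P. \<forall>k\<in>P. \<forall>i. l \<noteq> k \<and> pivot (vec R l) = Some i \<longrightarrow> pivot (vec R k) \<noteq> Some i)"

text \<open>The exit condition of the inner loop, when \<open>v\<close> is the vector being
  reduced.\<close>

definition avoids_pivots :: "nat set \<Rightarrow> 's \<Rightarrow> nat set \<Rightarrow> bool" where
  "avoids_pivots P R v \<longleftrightarrow> (\<forall>l\<in>P. \<forall>i. pivot (vec R l) = Some i \<longrightarrow> i \<notin> v)"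

text \<open>
  In a sum of vectors with distinct pivots, the pivot of largest rank is not cancelled.
\<close>

lemma span_avoids_pivots:
  assumes R: "bounded R" "distinct_pivots P R" and P: "finite P"
    and v: "v \<in> z2_span (vec R) P" "avoids_pivots P R v"
  shows "v = {}"
proof -
  obtain S where S: "S \<subseteq> P" "v = xsum (vec R) S" using v(1) by (auto simp: z2_span_def)
  define T where "T = {l \<in> S. vec R l \<noteq> {}}"
  have "finite T" using S P by (auto simp: T_def finite_subset)
  have piv: "pivot (vec R l) = Some (the (pivot (vec R l)))" if "l \<in> T" for l
    using that pivot_None[of "vec R l"] R(1) by (auto simp: T_def bounded_def)
  show ?thesis
  proof (cases "T = {}")
    case True
    then have "xsum (vec R) S = xsum (\<lambda>_. {}) S" by (intro xsum_cong) (auto simp: T_def)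
    then show ?thesis using S by (simp add: xsum_def)
  next
    case False
    then obtain l where l: "l \<in> T"
        "\<And>k. k \<in> T \<Longrightarrow> rank (the (pivot (vec R k))) \<le> rank (the (pivot (vec R l)))"
      using \<open>finite T\<close> obtains_MAX[of T "\<lambda>l. rank (the (pivot (vec R l)))"]
        by (metis (no_types, lifting) Max_ge finite_imageI imageI)
    define i where "i = the (pivot (vec R l))"
    have pi: "pivot (vec R l) = Some i" using piv l(1) by (simp add: i_def)
    have "{s \<in> S. i \<in> vec R s} = {l}"
    proof (rule Set.set_eqI, unfold mem_Collect_eq singleton_iff, rule iffI)
      fix k assume k: "k \<in> S \<and> i \<in> vec R k"
      then have "k \<in> T" by (auto simp: T_def)
      then obtain m where m: "pivot (vec R k) = Some m" using piv by blast
      have "rank i \<le> rank m" using pivot_Some[OF _ m] R(1) k by (auto simp: bounded_def)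
      moreover have "rank m \<le> rank i" using l(2)[OF \<open>k \<in> T\<close>] m by (simp add: i_def)
      moreover have "i \<in> vec R l" "m \<in> vec R k"
        using pivot_Some[OF _ pi] pivot_Some[OF _ m] R(1) by (auto simp: bounded_def)
      ultimately have "m = i"
        using inj_rank R(1) unfolding bounded_def inj_on_def by (metis order_antisym subsetD)
      then show "k = l" using m pi R(2) k l(1) S(1) by (auto simp: distinct_pivots_def T_def)
    next
      fix k assume "k = l"
      then show "k \<in> S \<and> i \<in> vec R k"
        using pivot_Some[OF _ pi] R(1) l(1) by (auto simp: bounded_def T_def)
    qed
    then have "i \<in> v" using S(2) by (simp add: xsum_def)
    then show ?thesis using v(2) pi l(1) S(1) by (auto simp: avoids_pivots_def T_def)
  qed
qed

text \<open>Invariant of the inner loop: only vector \<open>j\<close> changes, and only by vectors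
  before \<open>j\<close>, which the loop leaves alone. The last conjunct comes from
  termination.\<close>

lemma while_result_props:
  assumes js: "js = pre @ j # post" and R: "bounded R" and U: "while_result (step j) R U"
  shows "\<exists>w. vec U = (vec R)(j := w) \<and> w \<subseteq> {..<n} \<and>
     sym_diff (vec R j) w \<in> z2_span (vec R) (set pre) \<and> avoids_pivots (set pre) R w"
proof -
  have j: "j \<in> set js" "before j = set pre" "j \<notin> set pre"
    using js before[OF js] distinct by auto
  note B = z2_subspace_span[OF finite_set, of "vec R" pre]
  have "(step j)\<^sup>*\<^sup>* R U" using U by (simp add: while_result_def)
  then have "\<exists>w. vec U = (vec R)(j := w) \<and> w \<subseteq> {..<n} \<and> sym_diff (vec R j) w \<in> z2_span (vec R) (set pre)"
  proof (induction rule: rtranclp_induct)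
    case base
    have "vec R = (vec R)(j := vec R j)" by simp
    then show ?case using R B by (metis Diff_cancel Un_empty_left bounded_def z2_subspace_def)
  next
    case (step U U')
    then obtain w l where w: "vec U = (vec R)(j := w)" "w \<subseteq> {..<n}"
        "sym_diff (vec R j) w \<in> z2_span (vec R) (set pre)"
      and l: "l \<in> set pre" "vec U' = (vec U)(j := sym_diff (vec U j) (vec U l))"
      using step_iff[OF j(1)] j(2) by blast
    have "vec U l = vec R l" "vec U j = w" using w l j(3) by auto
    then have "vec U' = (vec R)(j := sym_diff w (vec R l))" using w l by simp
    moreover have "sym_diff w (vec R l) \<subseteq> {..<n}" using w R unfolding bounded_def by blast
    moreover have "sym_diff (sym_diff (vec R j) w) (vec R l) \<in> z2_span (vec R) (set pre)"
      using w(3) B z2_span_base[OF l(1)] by (auto simp: z2_subspace_def)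
    moreover have "sym_diff (sym_diff (vec R j) w) (vec R l) = sym_diff (vec R j) (sym_diff w (vec R l))"
      by blast
    ultimately show ?case by metis
  qed
  then obtain w where w: "vec U = (vec R)(j := w)" "w \<subseteq> {..<n}"
     "sym_diff (vec R j) w \<in> z2_span (vec R) (set pre)" by blast
  have "avoids_pivots (set pre) R w"
    unfolding avoids_pivots_def
  proof (intro ballI allI impI notI)
    fix l i assume l: "l \<in> set pre" "pivot (vec R l) = Some i" "i \<in> w"
    \<comment> \<open>Surjectivity of \<open>vec\<close> supplies a state for the addition that
      would still be possible, so the loop could not have stopped.\<close>
    obtain U' where "vec U' = (vec U)(j := sym_diff (vec U j) (vec U l))"
      using bij_vec by (metis bij_pointE)
    moreover have "vec U l = vec R l" "vec U j = w" using w l j(3) by auto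
    ultimately have "pivot (vec U l) = Some i \<and> i \<in> vec U j \<and> vec U' = (vec U)(j := sym_diff (vec U j) (vec U l))"
      using l by simp
    then have "step j U U'" using step_iff[OF j(1)] l(1) j(2) by blast
    then show False using U by (auto simp: while_result_def)
  qed
  with w show ?thesis by blast
qed

text \<open>
  Read as a binary number whose digits are ordered by \<open>rank\<close>, the \<open>j\<close>-th vector decreases with
  every step.
\<close>

lemma while_result_exists:
  assumes js: "js = pre @ j # post" and R: "bounded R"
  shows "\<exists>U. while_result (step j) R U"
  using R
proof (induction "\<Sum>k\<in>vec R j. (2::nat) ^ rank k" arbitrary: R rule: less_induct)
  case less
  show ?case
  proof (cases "\<exists>U. step j R U")
    case True
    then obtain U where U: "step j R U" by blast
    have j: "j \<in> set js" "before j = set pre" "j \<notin> set pre"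
      using js before[OF js] distinct by auto
    obtain l i where l: "l \<in> set pre" "pivot (vec R l) = Some i" "i \<in> vec R j"
        "vec U = (vec R)(j := sym_diff (vec R j) (vec R l))"
      using U step_iff[OF j(1)] j(2) by blast
    have b: "vec R k \<subseteq> {..<n}" for k using less.prems by (simp add: bounded_def)
    then have fin: "finite (vec R k)" for k using finite_subset by blast
    have "bounded U" using b l(4) by (auto simp: bounded_def)
    moreover have "(\<Sum>k\<in>vec U j. (2::nat) ^ rank k) < (\<Sum>k\<in>vec R j. 2 ^ rank k)"
      unfolding l(4) fun_upd_same
      by (rule sum_power2_sym_diff_less[of _ _ _ i])
        (use fin b l pivot_Some[OF b l(2)] inj_on_subset[OF inj_rank b] in auto)
    ultimately obtain V where "while_result (step j) U V" using less.hyps by blast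
    then have "while_result (step j) R V"
      using U unfolding while_result_def by (meson converse_rtranclp_into_rtranclp)
    then show ?thesis by blast
  qed (auto simp: while_result_def)
qed

text \<open>Invariant of the outer loop. The last clause speaks of the original vectors only, which
  is what frees the tri-partition from the algorithm; the clause on spans allows it to be extended
  to the next vector.\<close>

definition reduced_prefix :: "'s \<Rightarrow> nat list \<Rightarrow> 's \<Rightarrow> bool" where
  "reduced_prefix R0 pre R \<longleftrightarrow>
     bounded R \<and> distinct_pivots (set pre) R \<and> (\<forall>j. j \<notin> set pre \<longrightarrow> vec R j = vec R0 j) \<and>
     z2_span (vec R) (set pre) = z2_span (vec R0) (set pre) \<and>
     (\<forall>j\<in>set pre. vec R j \<noteq> {} \<longleftrightarrow> vec R0 j \<notin> z2_span (vec R0) (before j))"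

lemma reduced_prefix_snoc:
  assumes js: "js = pre @ j # post" and R: "reduced_prefix R0 pre R"
    and U: "while_result (step j) R U"
  shows "reduced_prefix R0 (pre @ [j]) U"
proof -
  let ?B = "z2_span (vec R) (set pre)"
  have j: "before j = set pre" "j \<notin> set pre" using js before[OF js] distinct by auto
  have b: "bounded R" and dp: "distinct_pivots (set pre) R"
    and out: "\<And>k. k \<notin> set pre \<Longrightarrow> vec R k = vec R0 k"
    and sp: "?B = z2_span (vec R0) (set pre)"
    and nz: "\<And>k. k \<in> set pre \<Longrightarrow> vec R k \<noteq> {} \<longleftrightarrow> vec R0 k \<notin> z2_span (vec R0) (before k)"
    using R by (auto simp: reduced_prefix_def)
  obtain w where w: "vec U = (vec R)(j := w)" "w \<subseteq> {..<n}" "sym_diff (vec R j) w \<in> ?B"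
      "avoids_pivots (set pre) R w"
    using while_result_props[OF js b U] by blast
  have B: "z2_subspace ?B" by (simp add: z2_subspace_span)
  have U_pre: "vec U k = vec R k" if "k \<in> set pre" for k using that w j(2) by auto
  have "bounded U" using b w by (auto simp: bounded_def)
  moreover have "distinct_pivots (set (pre @ [j])) U"
  proof -
    \<comment> \<open>A pivot of \<open>w\<close> is an element of \<open>w\<close>, and
      \<open>w\<close> contains no earlier pivot.\<close>
    have "pivot (vec R l) \<noteq> pivot w" if "l \<in> set pre" "pivot (vec R l) = Some i" for l i
      using that w(4) pivot_Some[OF w(2)] by (metis avoids_pivots_def)
    then have w': "pivot w \<noteq> Some i" if "l \<in> set pre" "pivot (vec R l) = Some i" for l i
      using that by metis
    show ?thesis
      unfolding distinct_pivots_def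
    proof (intro ballI allI impI, elim conjE)
      fix l k i assume lk: "l \<in> set (pre @ [j])" "k \<in> set (pre @ [j])" "l \<noteq> k"
        and p: "pivot (vec U l) = Some i"
      consider "l \<in> set pre" "k \<in> set pre" | "l = j" "k \<in> set pre" | "l \<in> set pre" "k = j"
        using lk by auto
      then show "pivot (vec U k) \<noteq> Some i"
      proof cases
        case 1
        then show ?thesis using dp lk(3) p U_pre by (metis distinct_pivots_def)
      next
        case 2
        then show ?thesis using w' p U_pre w(1) by (metis fun_upd_same)
      next
        case 3
        then show ?thesis using w' p U_pre w(1) by (metis fun_upd_same)
      qed
    qed
  qed
  moreover have "\<forall>k. k \<notin> set (pre @ [j]) \<longrightarrow> vec U k = vec R0 k" using out w(1) by auto
  moreover have "z2_span (vec U) (set (pre @ [j])) = z2_span (vec R0) (set (pre @ [j]))"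
  proof -
    have "z2_span (vec U) (set pre) = ?B" using U_pre by (rule z2_span_cong)
    moreover have "sym_diff w ` ?B = sym_diff (vec R0 j) ` ?B"
      using z2_subspace_translate_eq[OF B w(3)] out[OF j(2)] by simp
    moreover have "vec U j = w" "set (pre @ [j]) = insert j (set pre)" using w(1) by auto
    ultimately show ?thesis
      using z2_span_insert[OF finite_set j(2), of "vec U"] z2_span_insert[OF finite_set j(2), of "vec R0"] sp
      by metis
  qed
  moreover have "w \<noteq> {} \<longleftrightarrow> vec R0 j \<notin> z2_span (vec R0) (before j)"
  proof -
    have "sym_diff w (sym_diff (vec R j) w) = vec R j" by blast
    then have "w \<in> ?B \<longleftrightarrow> vec R j \<in> ?B"
      using z2_subspace_sym_diff_iff[OF B w(3), of w] by simp
    \<comment> \<open>Distinct pivots pay off here: a fully reduced vector in the span of the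
      earlier ones is zero.\<close>
    moreover have "w = {}" if "w \<in> ?B" by (rule span_avoids_pivots[OF b dp _ that w(4)]) simp
    moreover have "{} \<in> ?B" using B by (simp add: z2_subspace_def)
    ultimately show ?thesis using out[OF j(2)] j(1) sp by auto
  qed
  moreover have "\<forall>k\<in>set pre. vec U k \<noteq> {} \<longleftrightarrow> vec R0 k \<notin> z2_span (vec R0) (before k)"
    using nz U_pre by metis
  ultimately show ?thesis using w(1) unfolding reduced_prefix_def by simp
qed

text \<open>The difference of two results lies in the span of the earlier vectors and avoids their
  pivots, hence vanishes.\<close>

lemma while_result_unique:
  assumes js: "js = pre @ j # post" and R: "reduced_prefix R0 pre R"
    and U: "while_result (step j) R U" and V: "while_result (step j) R V"
  shows "U = V"
proof -
  let ?B = "z2_span (vec R) (set pre)"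
  have B: "z2_subspace ?B" by (simp add: z2_subspace_span)
  have b: "bounded R" and dp: "distinct_pivots (set pre) R"
    using R by (auto simp: reduced_prefix_def)
  obtain w where w: "vec U = (vec R)(j := w)" "sym_diff (vec R j) w \<in> ?B" "avoids_pivots (set pre) R w"
    using while_result_props[OF js b U] by blast
  obtain x where x: "vec V = (vec R)(j := x)" "sym_diff (vec R j) x \<in> ?B" "avoids_pivots (set pre) R x"
    using while_result_props[OF js b V] by blast
  have "sym_diff (sym_diff (vec R j) w) (sym_diff (vec R j) x) = sym_diff w x" by blast
  then have "sym_diff w x \<in> ?B" using w(2) x(2) B unfolding z2_subspace_def by metis
  moreover have "avoids_pivots (set pre) R (sym_diff w x)"
    using w(3) x(3) by (auto simp: avoids_pivots_def)
  ultimately have "sym_diff w x = {}" by (intro span_avoids_pivots[OF b dp]) auto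
  then have "w = x" by blast
  then show ?thesis using w x bij_vec by (metis bij_is_inj injD)
qed

text \<open>Existence, correctness and uniqueness are proved in one induction, since the uniqueness
  of each inner result depends on the invariant for the state it starts from.\<close>

lemma for_result_exists:
  assumes "js = pre @ post" "reduced_prefix R0 pre R"
  shows "\<exists>U. for_result step post R U \<and> reduced_prefix R0 js U \<and> (\<forall>V. for_result step post R V \<longrightarrow> V = U)"
  using assms
proof (induction post arbitrary: pre R)
  case (Cons j post)
  have "bounded R" using Cons.prems by (simp add: reduced_prefix_def)
  then obtain W where W: "while_result (step j) R W" using while_result_exists Cons.prems by blast
  have "reduced_prefix R0 (pre @ [j]) W" using reduced_prefix_snoc Cons.prems W by blast
  then obtain U where "for_result step post W U" "reduced_prefix R0 js U"
      "\<forall>V. for_result step post W V \<longrightarrow> V = U"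
    using Cons.IH[of "pre @ [j]" W] Cons.prems(1) by (metis append.assoc append_Cons append_Nil)
  moreover have "W' = W" if "while_result (step j) R W'" for W'
    using while_result_unique Cons.prems W that by blast
  ultimately show ?case using W unfolding for_result.simps by metis
next
  case Nil
  then show ?case unfolding for_result.simps by (metis append_Nil2)
qed

theorem reduction_correct:
  assumes "bounded R0"
  shows "reduced_prefix R0 js (THE R. for_result step js R0 R)"
proof -
  have "reduced_prefix R0 [] R0" using assms by (auto simp: reduced_prefix_def distinct_pivots_def)
  then obtain U where U: "for_result step js R0 U" "reduced_prefix R0 js U"
      "\<forall>V. for_result step js R0 V \<longrightarrow> V = U"
    using for_result_exists[of "[]" js] by (metis append_Nil)
  from U(1,3) have "(THE R. for_result step js R0 R) = U" by (intro the_equality) blast+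
  with U(2) show ?thesis by simp
qed

end

section \<open>Tri-partitions of filtered chain complexes\<close>

lemma sym_diff_eq_empty: "sym_diff a b = {} \<longleftrightarrow> a = b"
  by blast

lemma sym_diff_cancel_left: "sym_diff a (sym_diff a b) = b"
  by blast

lemma z2_subspaceD: "\<lbrakk>z2_subspace B; a \<in> B; b \<in> B\<rbrakk> \<Longrightarrow> sym_diff a b \<in> B"
  by (simp add: z2_subspace_def)

lemma z2_subspace_translate_self:
  assumes "z2_subspace B" "b \<in> B"
  shows "sym_diff b ` B = B"
  using z2_subspace_translate_eq[OF assms(1), of b "{}"] assms(2) by simp

lemma z2_span_mono: "X \<subseteq> Y \<Longrightarrow> z2_span f X \<subseteq> z2_span f Y"
  unfolding z2_span_def by (intro image_mono Pow_mono)

text \<open>One new generator makes the old span a subspace of index at most two, so any two new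
  elements are congruent modulo it.\<close>

lemma z2_span_insert_diff:
  assumes X: "finite X" and a: "a \<in> z2_span f (insert x X)" "a \<notin> z2_span f X"
    and b: "b \<in> z2_span f (insert x X)" "b \<notin> z2_span f X"
  shows "sym_diff a b \<in> z2_span f X"
proof -
  have "x \<notin> X" using a by (metis insert_absorb)
  then have *: "c \<in> sym_diff (f x) ` z2_span f X" if "c \<in> z2_span f (insert x X)" "c \<notin> z2_span f X" for c
    using that by (simp add: z2_span_insert[OF X])
  obtain u where u: "u \<in> z2_span f X" "a = sym_diff (f x) u" using *[OF a] by (elim imageE)
  obtain v where v: "v \<in> z2_span f X" "b = sym_diff (f x) v" using *[OF b] by (elim imageE)
  have "sym_diff a b = sym_diff u v" unfolding u(2) v(2) by blast
  then show ?thesis using z2_subspaceD[OF z2_subspace_span[OF X] u(1) v(1)] by simp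
qed

lemma rev_eq_append_Cons_iff: "rev xs = pre @ s # post \<longleftrightarrow> xs = rev post @ s # rev pre"
  by (metis append.assoc append_Cons append_Nil rev.simps(2) rev_append rev_rev_ident)

text \<open>The last axiom is the vanishing of the double boundary. Incidence is an arbitrary
  relation and the dimension an arbitrary integer so that reversing the list, transposing the
  relation and negating the dimension gives another instance.\<close>

locale filtered_complex =
  fixes xs :: "'c list" and inc :: "'c \<Rightarrow> 'c \<Rightarrow> bool" and dim :: "'c \<Rightarrow> int"
  assumes distinct_cells: "distinct xs"
    and inc_dim: "\<lbrakk>t \<in> set xs; s \<in> set xs; inc t s\<rbrakk> \<Longrightarrow> dim t = dim s - 1"
    and inc_prefix: "\<lbrakk>xs = pre @ s # post; t \<in> set xs; inc t s\<rbrakk> \<Longrightarrow> t \<in> set pre"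
    and even_inc_inc: "\<lbrakk>u \<in> set xs; s \<in> set xs\<rbrakk> \<Longrightarrow> even (card {t \<in> set xs. inc u t \<and> inc t s})"
begin

definition facets :: "'c \<Rightarrow> 'c set" where "facets s = {t \<in> set xs. inc t s}"

definition cofacets :: "'c \<Rightarrow> 'c set" where "cofacets t = {s \<in> set xs. inc t s}"

definition cells_of :: "int \<Rightarrow> 'c set" where "cells_of p = {s \<in> set xs. dim s = p}"

text \<open>The span runs over all earlier cells, whatever their dimension, because this is what the
  matrix reduction delivers. Homogeneity of the boundary map later confines it to dimension
  \<open>p\<close>.\<close>

definition lower :: "int \<Rightarrow> 'c set" where
  "lower p = {s. \<exists>pre post. xs = pre @ s # post \<and> dim s = p \<and> facets s \<notin> z2_span facets (set pre)}"

definition upper :: "int \<Rightarrow> 'c set" where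
  "upper p = {s. \<exists>pre post. xs = pre @ s # post \<and> dim s = p \<and> cofacets s \<notin> z2_span cofacets (set post)}"

definition rest :: "int \<Rightarrow> 'c set" where "rest p = cells_of p - lower p - upper p"

definition cycs :: "int \<Rightarrow> 'c set set" where
  "cycs p = {c. c \<subseteq> cells_of p \<and> xsum facets c = {}}"

definition bnds :: "int \<Rightarrow> 'c set set" where
  "bnds p = z2_span facets (cells_of (p + 1))"

definition can_cycle :: "int \<Rightarrow> 'c \<Rightarrow> 'c set" where
  "can_cycle p s = (THE z. z \<in> cycs p \<and> z \<noteq> {} \<and> z \<subseteq> lower p \<union> {s})"

section \<open>Duality: reversed order and transposed incidence\<close>

lemma dual: "filtered_complex (rev xs) (\<lambda>t s. inc s t) (\<lambda>s. - dim s)"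
proof
  fix t s pre post assume *: "rev xs = pre @ s # post" "t \<in> set (rev xs)" "inc s t"
  from *(1) have xs: "xs = rev post @ s # rev pre" unfolding rev_eq_append_Cons_iff .
  show "t \<in> set pre"
  proof (rule ccontr)
    assume "t \<notin> set pre"
    with *(2) xs consider "t = s" | "t \<in> set post" by auto
    then show False
    proof cases
      case 1
      then show False using inc_prefix[OF xs, of s] * xs distinct_cells by auto
    next
      case 2
      then obtain a b where "rev post = a @ t # b" by (metis set_rev split_list)
      then have "xs = a @ t # (b @ s # rev pre)" using xs by simp
      moreover have "s \<in> set xs" using xs by simp
      ultimately have "s \<in> set a" using inc_prefix * by blast
      then show False using \<open>xs = a @ t # (b @ s # rev pre)\<close> distinct_cells by auto
    qed
  qed
next
  fix u s assume "u \<in> set (rev xs)" "s \<in> set (rev xs)"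
  then show "even (card {t \<in> set (rev xs). inc t u \<and> inc s t})"
    using even_inc_inc[of s u] by (simp add: conj_commute)
qed (use distinct_cells inc_dim in auto)

lemma dual_cells_of: "filtered_complex.cells_of (rev xs) (\<lambda>s. - dim s) (- p) = cells_of p"
  unfolding filtered_complex.cells_of_def[OF dual] cells_of_def by simp

lemma dual_facets: "filtered_complex.facets (rev xs) (\<lambda>t s. inc s t) = cofacets"
  unfolding filtered_complex.facets_def[OF dual] cofacets_def by (simp add: fun_eq_iff)

lemma dual_cofacets: "filtered_complex.cofacets (rev xs) (\<lambda>t s. inc s t) = facets"
  unfolding filtered_complex.cofacets_def[OF dual] facets_def by (simp add: fun_eq_iff)

lemma dual_lower: "filtered_complex.lower (rev xs) (\<lambda>t s. inc s t) (\<lambda>s. - dim s) (- p) = upper p"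
  unfolding filtered_complex.lower_def[OF dual] upper_def dual_facets rev_eq_append_Cons_iff
  by (rule Collect_cong) (metis neg_equal_iff_equal rev_rev_ident set_rev)

lemma dual_upper: "filtered_complex.upper (rev xs) (\<lambda>t s. inc s t) (\<lambda>s. - dim s) (- p) = lower p"
  unfolding filtered_complex.upper_def[OF dual] lower_def dual_cofacets rev_eq_append_Cons_iff
  by (rule Collect_cong) (metis neg_equal_iff_equal rev_rev_ident set_rev)

lemma dual_rest: "filtered_complex.rest (rev xs) (\<lambda>t s. inc s t) (\<lambda>s. - dim s) (- p) = rest p"
  unfolding filtered_complex.rest_def[OF dual] rest_def dual_cells_of dual_lower dual_upper by blast

lemma facets_subset: "facets s \<subseteq> set xs"
  by (auto simp: facets_def)

lemma cofacets_subset: "cofacets s \<subseteq> set xs"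
  by (auto simp: cofacets_def)

lemma cells_of_subset: "cells_of p \<subseteq> set xs"
  by (auto simp: cells_of_def)

lemma facets_subset_cells_of: "s \<in> cells_of p \<Longrightarrow> facets s \<subseteq> cells_of (p - 1)"
  using inc_dim by (auto simp: facets_def cells_of_def)

lemma facets_prefix: "xs = pre @ s # post \<Longrightarrow> facets s \<subseteq> set pre"
  unfolding facets_def using inc_prefix by blast

lemma finite_cells_of [simp]: "finite (cells_of p)"
  by (simp add: cells_of_def)

lemma finite_subset_cells_of: "c \<subseteq> cells_of p \<Longrightarrow> finite c"
  using finite_subset[OF _ finite_cells_of] .

lemma lower_subset: "lower p \<subseteq> cells_of p"
  by (auto simp: lower_def cells_of_def)

lemma upper_subset: "upper p \<subseteq> cells_of p"
  by (auto simp: upper_def cells_of_def)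

lemma lower_prefix_iff:
  assumes "xs = pre @ s # post"
  shows "s \<in> lower p \<longleftrightarrow> dim s = p \<and> facets s \<notin> z2_span facets (set pre)"
proof -
  have "pre' = pre" if "xs = pre' @ s # post'" for pre' post'
  proof -
    have "s \<notin> set pre" "s \<notin> set post" using assms distinct_cells by simp_all
    then show ?thesis using append_Cons_eq_iff[of s pre post pre' post'] that assms by simp
  qed
  then show ?thesis using assms unfolding lower_def by blast
qed

text \<open>The boundary map is graded: the part of a boundary in dimension \<open>q - 1\<close>
  comes from the cells of dimension \<open>q\<close> alone.\<close>

lemma xsum_facets_Int_cells_of:
  assumes "S \<subseteq> set xs"
  shows "xsum facets (S \<inter> cells_of q) = xsum facets S \<inter> cells_of (q - 1)"
proof (rule Set.set_eqI)
  fix x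
  have "{s \<in> S \<inter> cells_of q. x \<in> facets s} = (if x \<in> cells_of (q - 1) then {s \<in> S. x \<in> facets s} else {})"
    using assms inc_dim by (auto simp: facets_def cells_of_def)
  then show "x \<in> xsum facets (S \<inter> cells_of q) \<longleftrightarrow> x \<in> xsum facets S \<inter> cells_of (q - 1)"
    by (simp add: xsum_def)
qed

lemma z2_span_facets_cells_of:
  assumes "v \<in> z2_span facets X" "X \<subseteq> set xs" "v \<subseteq> cells_of (q - 1)"
  shows "v \<in> z2_span facets (cells_of q \<inter> X)"
proof -
  obtain S where S: "S \<subseteq> X" "v = xsum facets S" using assms(1) by (auto simp: z2_span_def)
  have "v = xsum facets (S \<inter> cells_of q)"
    using xsum_facets_Int_cells_of[of S q] S assms by auto
  then show ?thesis using S by (auto simp: z2_span_def)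
qed

lemma facets_eq_xsum:
  assumes "finite c" "x \<in> c" "xsum facets c = {}"
  shows "facets x = xsum facets (c - {x})"
proof -
  have "xsum facets (insert x (c - {x})) = sym_diff (facets x) (xsum facets (c - {x}))"
    using assms by (intro xsum_insert) auto
  then have "sym_diff (facets x) (xsum facets (c - {x})) = {}" using assms by (simp add: insert_absorb)
  then show ?thesis by (simp only: sym_diff_eq_empty)
qed

lemma lower_independent:
  assumes "c \<subseteq> lower p" "xsum facets c = {}"
  shows "c = {}"
proof -
  \<comment> \<open>For non-empty \<open>c\<close> this says that no prefix contains all of
    \<open>c\<close>. At the prefix ending in the last cell of \<open>c\<close>, the column of that
    cell would be a sum of earlier ones.\<close>
  have "c \<inter> set pre = {} \<or> \<not> c \<subseteq> set pre" if "xs = pre @ post" for pre post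
    using that
  proof (induction pre arbitrary: post rule: rev_induct)
    case (snoc x pre)
    then have xs: "xs = pre @ x # post" by simp
    show ?case
    proof (cases "x \<in> c")
      case True
      have "x \<in> lower p" using True assms by blast
      then have *: "facets x \<notin> z2_span facets (set pre)" using lower_prefix_iff[OF xs] by blast
      have "\<not> c \<subseteq> set (pre @ [x])"
      proof
        assume c: "c \<subseteq> set (pre @ [x])"
        then have "finite c" by (rule finite_subset) simp
        then have "facets x = xsum facets (c - {x})" using facets_eq_xsum True assms by blast
        moreover have "c - {x} \<subseteq> set pre" using c by auto
        ultimately show False using * z2_span_memI by metis
      qed
      then show ?thesis ..
    next
      case False
      then show ?thesis using snoc.IH[OF xs] by auto
    qed
  qed simp
  from this[of xs "[]"] show ?thesis using assms lower_subset cells_of_subset by blast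
qed

text \<open>Greedy choice of a basis: a cell of dimension \<open>p\<close> outside
  \<open>lower p\<close> contributes a column that is already spanned.\<close>

lemma z2_span_lower_prefix:
  assumes "xs = pre @ post"
  shows "z2_span facets (cells_of p \<inter> set pre) = z2_span facets (lower p \<inter> set pre)"
  using assms
proof (induction pre arbitrary: post rule: rev_induct)
  case (snoc x pre)
  then have xs: "xs = pre @ x # post" by simp
  note IH = snoc.IH[OF xs]
  have x: "x \<notin> set pre" using xs distinct_cells by simp
  consider "x \<notin> cells_of p" | "x \<in> lower p" | "x \<in> cells_of p" "x \<notin> lower p" by blast
  then show ?case
  proof cases
    case 1
    then have eq: "cells_of p \<inter> set (pre @ [x]) = cells_of p \<inter> set pre"
      "lower p \<inter> set (pre @ [x]) = lower p \<inter> set pre" using lower_subset by auto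
    show ?thesis unfolding eq by (rule IH)
  next
    case 2
    then have eq: "cells_of p \<inter> set (pre @ [x]) = insert x (cells_of p \<inter> set pre)"
      "lower p \<inter> set (pre @ [x]) = insert x (lower p \<inter> set pre)" using lower_subset by auto
    then show ?thesis unfolding eq using IH x by (simp add: z2_span_insert)
  next
    case 3
    then have eq: "cells_of p \<inter> set (pre @ [x]) = insert x (cells_of p \<inter> set pre)"
      "lower p \<inter> set (pre @ [x]) = lower p \<inter> set pre" by auto
    let ?B = "z2_span facets (cells_of p \<inter> set pre)"
    have B: "z2_subspace ?B" by (simp add: z2_subspace_span)
    have "facets x \<in> z2_span facets (set pre)"
      using 3 lower_prefix_iff[OF xs] by (auto simp: cells_of_def)
    then have "facets x \<in> ?B"
      using z2_span_facets_cells_of facets_subset_cells_of[OF 3(1)] xs by (metis Un_upper1 set_append)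
    then have "sym_diff (facets x) ` ?B = ?B" by (rule z2_subspace_translate_self[OF B])
    then show ?thesis unfolding eq using IH x by (simp add: z2_span_insert)
  qed
qed simp

lemma z2_span_lower: "z2_span facets (cells_of p) = z2_span facets (lower p)"
proof -
  have "cells_of p \<inter> set xs = cells_of p" "lower p \<inter> set xs = lower p"
    using lower_subset cells_of_subset by blast+
  then show ?thesis using z2_span_lower_prefix[of xs "[]" p] by simp
qed

lemma xsum_facets_facets:
  assumes "s \<in> set xs"
  shows "xsum facets (facets s) = {}"
proof -
  have "even (card {t \<in> facets s. u \<in> facets t})" for u
  proof (cases "u \<in> set xs")
    case True
    then show ?thesis using even_inc_inc[OF True assms] by (simp add: facets_def conj_ac)
  qed (simp add: facets_def)
  then show ?thesis by (simp add: xsum_def)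
qed

lemma bd_bd:
  assumes "c \<subseteq> set xs"
  shows "xsum facets (xsum facets c) = {}"
proof -
  have "xsum facets (xsum facets c) = xsum (\<lambda>s. xsum facets (facets s)) c"
    using assms finite_subset[OF facets_subset] finite_subset by (intro xsum_xsum) auto
  also have "\<dots> = xsum (\<lambda>s. {}) c" using assms xsum_facets_facets by (intro xsum_cong) auto
  finally show ?thesis by (simp add: xsum_def)
qed

lemma mem_bd_iff:
  assumes "y \<subseteq> set xs"
  shows "t \<in> xsum facets y \<longleftrightarrow> t \<in> set xs \<and> odd (card (cofacets t \<inter> y))"
proof -
  have "{s \<in> y. t \<in> facets s} = (if t \<in> set xs then cofacets t \<inter> y else {})"
    using assms by (auto simp: facets_def cofacets_def)
  then show ?thesis by (simp add: xsum_def)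
qed

text \<open>Both sides are the parity of the number of incident pairs with one cell in
  \<open>c\<close> and one in \<open>x\<close>.\<close>

lemma bd_cobd_adjoint:
  assumes "c \<subseteq> set xs" "x \<subseteq> set xs"
  shows "odd (card (xsum cofacets c \<inter> x)) \<longleftrightarrow> odd (card (c \<inter> xsum facets x))"
proof -
  have "{t \<in> c. s \<in> cofacets t} = facets s \<inter> c" if "s \<in> x" for s
    using assms that by (auto simp: facets_def cofacets_def)
  then have "xsum cofacets c \<inter> x = {s \<in> x. odd (card (facets s \<inter> c))}"
    by (auto simp: xsum_def)
  then show ?thesis using odd_card_xsum_Int[of x c facets] assms finite_subset[OF _ finite_set]
    by (metis Int_commute)
qed

text \<open>The separating functional becomes a chain once it is cut down to cells of the complex;
  rows do not see the rest of it.\<close>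

lemma cofacets_separation:
  assumes "X \<subseteq> set xs" "cofacets s \<notin> z2_span cofacets X"
  shows "\<exists>y\<subseteq>set xs. odd (card (cofacets s \<inter> y)) \<and> (\<forall>t\<in>X. even (card (cofacets t \<inter> y)))"
proof -
  have fin: "finite (cofacets t)" for t by (simp add: cofacets_def)
  obtain y where y: "odd (card (cofacets s \<inter> y))" "\<forall>t\<in>X. even (card (cofacets t \<inter> y))"
    using xsum_separation[of X "cofacets s" cofacets] assms fin finite_subset[OF _ finite_set]
    unfolding z2_span_def by blast
  have "cofacets t \<inter> (y \<inter> set xs) = cofacets t \<inter> y" for t using cofacets_subset by blast
  then show ?thesis using y by (metis inf_le2)
qed

text \<open>
  If the row of \<open>x\<close> is not a sum of later rows, some chain is orthogonal to all later rows but not to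
  that of \<open>x\<close>.  Its boundary is a cycle whose last cell is \<open>x\<close>, so the column of \<open>x\<close> is a sum
  of earlier ones.
\<close>

lemma lower_upper_disjoint: "lower p \<inter> upper q = {}"
proof (rule equals0I)
  fix x assume x: "x \<in> lower p \<inter> upper q"
  then obtain pre post where xs: "xs = pre @ x # post" "cofacets x \<notin> z2_span cofacets (set post)"
    by (auto simp: upper_def)
  obtain y where y: "y \<subseteq> set xs" "odd (card (cofacets x \<inter> y))" "\<forall>t\<in>set post. even (card (cofacets t \<inter> y))"
    using cofacets_separation[OF _ xs(2)] xs(1) by auto
  let ?b = "xsum facets y"
  have "x \<in> ?b" using mem_bd_iff[OF y(1)] y xs(1) by simp
  moreover have b: "?b \<subseteq> insert x (set pre)" using mem_bd_iff[OF y(1)] y(3) xs(1) by auto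
  moreover have "finite ?b" using b by (rule finite_subset) simp
  ultimately have "facets x = xsum facets (?b - {x})" using facets_eq_xsum bd_bd[OF y(1)] by blast
  moreover have "?b - {x} \<subseteq> set pre" using b by blast
  ultimately have "facets x \<in> z2_span facets (set pre)" using z2_span_memI by metis
  then show False using x lower_prefix_iff[OF xs(1)] by blast
qed

lemma upper_Un_rest: "upper p \<union> rest p = cells_of p - lower p"
  using lower_upper_disjoint[of p p] upper_subset[of p] unfolding rest_def by blast

text \<open>Statements about rows are the statements about columns of the dual complex in dimension
  \<open>- p\<close>.\<close>

lemma z2_span_upper: "z2_span cofacets (cells_of p) = z2_span cofacets (upper p)"
  using filtered_complex.z2_span_lower[OF dual, of "- p"] by (simp add: dual_facets dual_cells_of dual_lower)

lemma upper_independent: "\<lbrakk>c \<subseteq> upper p; xsum cofacets c = {}\<rbrakk> \<Longrightarrow> c = {}"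
  using filtered_complex.lower_independent[OF dual, of c "- p"] by (simp add: dual_facets dual_lower)

lemma bnds_subset_cells_of:
  assumes "b \<in> bnds p"
  shows "b \<subseteq> cells_of p"
proof -
  obtain x where x: "x \<subseteq> cells_of (p + 1)" "b = xsum facets x"
    using assms by (auto simp: bnds_def z2_span_def)
  have "facets s \<subseteq> cells_of p" if "s \<in> x" for s
    using facets_subset_cells_of[of s "p + 1"] x(1) that by auto
  then show ?thesis unfolding x(2) by (rule xsum_subset)
qed

text \<open>The coefficient of a boundary at \<open>t\<close> is the pairing of the row of
  \<open>t\<close> with the bounding chain. The rows of \<open>upper p\<close> span all rows in
  dimension \<open>p\<close>, so the coefficients on \<open>upper p\<close> determine the
  others.\<close>

lemma bnds_Int_upper_empty:
  assumes b: "b \<in> bnds p" "b \<inter> upper p = {}"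
  shows "b = {}"
proof (rule equals0I)
  fix t assume t: "t \<in> b"
  obtain x where x: "x \<subseteq> cells_of (p + 1)" "b = xsum facets x"
    using b(1) by (auto simp: bnds_def z2_span_def)
  then have x': "x \<subseteq> set xs" using cells_of_subset by blast
  have "t \<in> cells_of p" using t b(1) bnds_subset_cells_of by blast
  then have "cofacets t \<in> z2_span cofacets (upper p)" using z2_span_upper z2_span_base by metis
  then obtain c where c: "c \<subseteq> upper p" "cofacets t = xsum cofacets c" by (auto simp: z2_span_def)
  have "odd (card (xsum cofacets c \<inter> x))" using t x(2) c(2) mem_bd_iff[OF x'] by metis
  moreover have "c \<subseteq> set xs" using c(1) upper_subset cells_of_subset by blast
  ultimately have "odd (card (c \<inter> b))" using bd_cobd_adjoint[OF _ x'] x(2) by blast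
  moreover have "c \<inter> b = {}" using b(2) c(1) by blast
  ultimately show False by simp
qed

lemma z2_subspace_bnds: "z2_subspace (bnds p)"
  by (simp add: bnds_def z2_subspace_span)

text \<open>The rows of \<open>upper p\<close> are independent, so some chain \<open>y\<close> pairs
  oddly with the row of \<open>x\<close> and evenly with all others of \<open>upper p\<close>. These
  pairings are the coefficients of the boundary of \<open>y\<close>.\<close>

lemma bnds_Int_upper_singleton:
  assumes x: "x \<in> upper p"
  shows "\<exists>b\<in>bnds p. b \<inter> upper p = {x}"
proof -
  have up: "upper p \<subseteq> set xs" using upper_subset cells_of_subset by blast
  have "cofacets x \<notin> z2_span cofacets (upper p - {x})"
  proof
    assume "cofacets x \<in> z2_span cofacets (upper p - {x})"
    then obtain c where c: "c \<subseteq> upper p - {x}" "cofacets x = xsum cofacets c" by (auto simp: z2_span_def)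
    have "c \<subseteq> cells_of p" using c(1) upper_subset by blast
    then have "finite c" by (rule finite_subset_cells_of)
    moreover have "x \<notin> c" using c(1) by blast
    ultimately have "xsum cofacets (insert x c) = {}" using c(2) by (simp add: xsum_insert)
    moreover have "insert x c \<subseteq> upper p" using c(1) x by blast
    ultimately show False using upper_independent[of "insert x c" p] by blast
  qed
  then obtain y where y: "y \<subseteq> set xs" "odd (card (cofacets x \<inter> y))"
      "\<forall>t\<in>upper p - {x}. even (card (cofacets t \<inter> y))"
    using cofacets_separation[of "upper p - {x}" x] up by blast
  \<comment> \<open>Only the cells of dimension \<open>p + 1\<close> in \<open>y\<close> contribute
    to coefficients in dimension \<open>p\<close>.\<close>
  define b where "b = xsum facets (y \<inter> cells_of (p + 1))"
  have "b = xsum facets y \<inter> cells_of p"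
    using xsum_facets_Int_cells_of[OF y(1), of "p + 1"] by (simp add: b_def)
  then have "b \<inter> upper p = {x}" using mem_bd_iff[OF y(1)] y(2,3) x upper_subset up by blast
  moreover have "b \<in> bnds p" unfolding b_def bnds_def by (intro z2_span_memI) blast
  ultimately show ?thesis by blast
qed

lemma bnds_Int_upper_onto:
  assumes "a \<subseteq> upper p"
  shows "\<exists>b\<in>bnds p. b \<inter> upper p = a"
proof -
  obtain g where g: "\<And>x. x \<in> upper p \<Longrightarrow> g x \<in> bnds p" "\<And>x. x \<in> upper p \<Longrightarrow> g x \<inter> upper p = {x}"
    using bnds_Int_upper_singleton[of _ p] by metis
  have "finite a" using assms upper_subset by (intro finite_subset_cells_of[of _ p]) (rule order_trans)
  then have "xsum g a \<in> bnds p" using assms g(1) by (intro z2_subspace_xsum z2_subspace_bnds) auto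
  moreover have "xsum g a \<inter> upper p = xsum (\<lambda>x. {x}) a"
    unfolding xsum_Int[symmetric] using assms g(2) by (intro xsum_cong) auto
  ultimately show ?thesis by auto
qed

section \<open>Cycles, canonical cycles and homology\<close>

lemma finite_cycs: "c \<in> cycs p \<Longrightarrow> finite c"
  unfolding cycs_def using finite_subset_cells_of by blast

lemma z2_subspace_cycs: "z2_subspace (cycs p)"
  unfolding z2_subspace_def
proof (intro conjI ballI)
  fix a b assume ab: "a \<in> cycs p" "b \<in> cycs p"
  then have "xsum facets (sym_diff a b) = {}"
    using xsum_sym_diff[OF finite_cycs[OF ab(1)] finite_cycs[OF ab(2)], of facets] by (simp add: cycs_def)
  then show "sym_diff a b \<in> cycs p" using ab by (simp add: cycs_def) blast
qed (simp add: cycs_def)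

lemma bnds_subset_cycs: "bnds p \<subseteq> cycs p"
proof
  fix b assume b: "b \<in> bnds p"
  then obtain x where x: "x \<subseteq> cells_of (p + 1)" "b = xsum facets x" by (auto simp: bnds_def z2_span_def)
  then have "xsum facets b = {}" using bd_bd cells_of_subset by blast
  then show "b \<in> cycs p" using bnds_subset_cells_of[OF b] by (simp add: cycs_def)
qed

lemma cycs_lower_empty: "\<lbrakk>c \<in> cycs p; c \<subseteq> lower p\<rbrakk> \<Longrightarrow> c = {}"
  using lower_independent by (simp add: cycs_def)

lemma can_cycle_ex1:
  assumes s: "s \<in> cells_of p" "s \<notin> lower p"
  shows "\<exists>!z. z \<in> cycs p \<and> z \<noteq> {} \<and> z \<subseteq> lower p \<union> {s}"
proof (rule ex_ex1I)
  have "facets s \<in> z2_span facets (lower p)" using s z2_span_lower z2_span_base by metis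
  then obtain c where c: "c \<subseteq> lower p" "facets s = xsum facets c" by (auto simp: z2_span_def)
  have "c \<subseteq> cells_of p" using c lower_subset by blast
  then have "finite c" by (rule finite_subset_cells_of)
  moreover have "s \<notin> c" using c(1) s(2) by blast
  ultimately have "xsum facets (insert s c) = {}" using c(2) by (simp add: xsum_insert)
  then have "insert s c \<in> cycs p" using \<open>c \<subseteq> cells_of p\<close> s by (simp add: cycs_def)
  then show "\<exists>z. z \<in> cycs p \<and> z \<noteq> {} \<and> z \<subseteq> lower p \<union> {s}" using c(1) by blast
next
  fix z w assume z: "z \<in> cycs p \<and> z \<noteq> {} \<and> z \<subseteq> lower p \<union> {s}"
    and w: "w \<in> cycs p \<and> w \<noteq> {} \<and> w \<subseteq> lower p \<union> {s}"
  have "s \<in> z" "s \<in> w" using z w cycs_lower_empty[of z p] cycs_lower_empty[of w p] by blast+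
  then have "sym_diff z w \<subseteq> lower p" using z w by blast
  moreover have "sym_diff z w \<in> cycs p" using z w z2_subspaceD[OF z2_subspace_cycs] by blast
  ultimately have "sym_diff z w = {}" using cycs_lower_empty by blast
  then show "z = w" by (simp only: sym_diff_eq_empty)
qed

lemma can_cycle:
  assumes s: "s \<in> cells_of p - lower p"
  shows "can_cycle p s \<in> cycs p" "can_cycle p s \<inter> - lower p = {s}"
proof -
  let ?z = "can_cycle p s"
  have z: "?z \<in> cycs p \<and> ?z \<noteq> {} \<and> ?z \<subseteq> lower p \<union> {s}"
    unfolding can_cycle_def by (rule theI') (use can_cycle_ex1 s in blast)
  then show "?z \<in> cycs p" by blast
  have "s \<in> ?z" using z cycs_lower_empty[of ?z p] by blast
  then show "?z \<inter> - lower p = {s}" using z s by blast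
qed

lemma can_cycle_unique:
  assumes "s \<in> cells_of p - lower p" "z \<in> cycs p" "z \<noteq> {}" "z \<subseteq> lower p \<union> {s}"
  shows "can_cycle p s = z"
  unfolding can_cycle_def using can_cycle_ex1[of s p] assms by (intro the1_equality) blast+

lemma xsum_can_cycle_mem:
  assumes "S \<subseteq> cells_of p - lower p"
  shows "xsum (can_cycle p) S \<in> cycs p"
proof -
  have "finite S" using assms by (intro finite_subset_cells_of[of _ p]) blast
  then show ?thesis using assms can_cycle(1) by (intro z2_subspace_xsum z2_subspace_cycs) auto
qed

text \<open>Outside \<open>lower p\<close> a canonical cycle is just the cell that names it, so the
  summands can be read off from the sum. Independence is immediate from this.\<close>

lemma xsum_can_cycle_Int:
  assumes "S \<subseteq> cells_of p - lower p"
  shows "xsum (can_cycle p) S \<inter> - lower p = S"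
proof -
  have "xsum (can_cycle p) S \<inter> - lower p = xsum (\<lambda>s. {s}) S"
    unfolding xsum_Int[symmetric] using assms can_cycle(2) by (intro xsum_cong) auto
  then show ?thesis by simp
qed

text \<open>No non-empty cycle lies inside \<open>lower p\<close>, so a cycle is determined by its
  part outside, and that part prescribes the summands.\<close>

lemma cycs_eq_xsum_can_cycle:
  assumes z: "z \<in> cycs p"
  shows "z = xsum (can_cycle p) (z - lower p)"
proof -
  let ?y = "xsum (can_cycle p) (z - lower p)"
  have sub: "z - lower p \<subseteq> cells_of p - lower p" using z by (auto simp: cycs_def)
  have "sym_diff z ?y \<in> cycs p" using z xsum_can_cycle_mem[OF sub] z2_subspaceD[OF z2_subspace_cycs] by blast
  moreover have "sym_diff z ?y \<subseteq> lower p"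
  proof
    fix t assume t: "t \<in> sym_diff z ?y"
    show "t \<in> lower p"
    proof (rule ccontr)
      assume n: "t \<notin> lower p"
      then have "t \<in> ?y \<longleftrightarrow> t \<in> z" using xsum_can_cycle_Int[OF sub] by blast
      with t show False by simp
    qed
  qed
  ultimately have "sym_diff z ?y = {}" by (rule cycs_lower_empty)
  then show ?thesis by (simp only: sym_diff_eq_empty)
qed

lemma rest_subset: "rest p \<subseteq> cells_of p - lower p"
  by (auto simp: rest_def)

text \<open>The sum stays inside \<open>lower p \<union> rest p\<close> and thus misses
  \<open>upper p\<close>; only the empty boundary does so.\<close>

lemma xsum_can_cycle_bnds:
  assumes "S \<subseteq> rest p" "xsum (can_cycle p) S \<in> bnds p"
  shows "S = {}"
proof -
  have S: "S \<subseteq> cells_of p - lower p" using assms rest_subset by blast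
  note Int = xsum_can_cycle_Int[OF S]
  have "upper p \<subseteq> - lower p" "S \<inter> upper p = {}" using lower_upper_disjoint assms(1) by (auto simp: rest_def)
  then have "xsum (can_cycle p) S \<inter> upper p = {}" using Int by blast
  then have "xsum (can_cycle p) S = {}" by (rule bnds_Int_upper_empty[OF assms(2)])
  then show ?thesis using Int by simp
qed

lemma cycs_mod_bnds:
  assumes x: "x \<in> cycs p"
  shows "\<exists>S\<subseteq>rest p. sym_diff x (xsum (can_cycle p) S) \<in> bnds p"
proof -
  \<comment> \<open>\<open>b\<close> is the boundary that agrees with \<open>x\<close> on
    \<open>upper p\<close>. Adding it moves the cycle into \<open>lower p \<union> rest p\<close>,
    where its canonical expansion uses cells of \<open>rest p\<close> only.\<close>
  obtain b where b: "b \<in> bnds p" "b \<inter> upper p = x \<inter> upper p"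
    using bnds_Int_upper_onto[of "x \<inter> upper p" p] by blast
  have z: "sym_diff x b \<in> cycs p"
    using b(1) bnds_subset_cycs by (intro z2_subspaceD[OF z2_subspace_cycs x]) blast
  have "sym_diff x b \<inter> upper p = {}" using b(2) by blast
  moreover have "sym_diff x b \<subseteq> cells_of p" using z by (simp add: cycs_def)
  ultimately have "sym_diff x b - lower p \<subseteq> rest p" unfolding rest_def by blast
  moreover have "sym_diff x (xsum (can_cycle p) (sym_diff x b - lower p)) = b"
    unfolding cycs_eq_xsum_can_cycle[OF z, symmetric] by (rule sym_diff_cancel_left)
  ultimately show ?thesis using b(1) by metis
qed

lemma basis_cycs: "z2_basis (z2_group (cycs p)) (upper p \<union> rest p) (can_cycle p)"
  unfolding upper_Un_rest
proof (rule z2_basis_z2_group[OF z2_subspace_cycs])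
  show "can_cycle p ` (cells_of p - lower p) \<subseteq> cycs p" using can_cycle(1) by blast
next
  fix S assume "S \<subseteq> cells_of p - lower p" "xsum (can_cycle p) S = {}"
  then show "S = {}" using xsum_can_cycle_Int[of S p] by simp
next
  fix x assume x: "x \<in> cycs p"
  then have "x - lower p \<subseteq> cells_of p - lower p" by (auto simp: cycs_def)
  then show "\<exists>S\<subseteq>cells_of p - lower p. finite S \<and> x = xsum (can_cycle p) S"
    using cycs_eq_xsum_can_cycle[OF x] finite_cycs[OF x] by blast
qed

lemma basis_homology:
  "z2_basis (z2_group (cycs p) Mod bnds p) (rest p) (\<lambda>s. bnds p #>\<^bsub>z2_group (cycs p)\<^esub> can_cycle p s)"
proof (rule z2_basis_quotient[OF z2_subspace_cycs z2_subspace_bnds bnds_subset_cycs])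
  show "can_cycle p ` rest p \<subseteq> cycs p" using can_cycle(1) rest_subset by blast
next
  fix x assume "x \<in> cycs p"
  then obtain S where S: "S \<subseteq> rest p" "sym_diff x (xsum (can_cycle p) S) \<in> bnds p"
    using cycs_mod_bnds by blast
  moreover have "finite S" using S(1) rest_subset by (intro finite_subset_cells_of[of _ p]) blast
  ultimately show "\<exists>S\<subseteq>rest p. finite S \<and> sym_diff x (xsum (can_cycle p) S) \<in> bnds p" by blast
qed (rule xsum_can_cycle_bnds)

section \<open>Prefixes and suffixes as complexes; behaviour of canonical cycles under
  truncation\<close>

lemma prefix_complex:
  assumes xs: "xs = pre @ post"
  shows "filtered_complex pre inc dim"
proof
  show "distinct pre" using distinct_cells xs by simp
next
  fix t s assume "t \<in> set pre" "s \<in> set pre" "inc t s"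
  then show "dim t = dim s - 1" using inc_dim xs by simp
next
  fix a s b t assume "pre = a @ s # b" "t \<in> set pre" "inc t s"
  moreover from this have "xs = a @ s # (b @ post)" "t \<in> set xs" using xs by auto
  ultimately show "t \<in> set a" using inc_prefix by blast
next
  fix u s assume us: "u \<in> set pre" "s \<in> set pre"
  then obtain a b where "pre = a @ s # b" by (metis split_list)
  then have "xs = a @ s # (b @ post)" "set a \<subseteq> set pre" using xs by auto
  then have "t \<in> set pre" if "t \<in> set xs" "inc t s" for t
    using inc_prefix that by blast
  then have "{t \<in> set pre. inc u t \<and> inc t s} = {t \<in> set xs. inc u t \<and> inc t s}" using xs by auto
  then show "even (card {t \<in> set pre. inc u t \<and> inc t s})" using even_inc_inc us xs by simp
qed

text \<open>A suffix is the complement of a subcomplex and is closed under cofacets instead of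
  facets. It is the reversal of a prefix of the dual.\<close>

lemma suffix_complex:
  assumes xs: "xs = pre @ post"
  shows "filtered_complex post inc dim"
proof -
  have "rev xs = rev post @ rev pre" using xs by simp
  then have "filtered_complex (rev post) (\<lambda>t s. inc s t) (\<lambda>s. - dim s)"
    by (rule filtered_complex.prefix_complex[OF dual])
  from filtered_complex.dual[OF this] show ?thesis by simp
qed

text \<open>The boundaries, of dimension \<open>p - 1\<close>, in the subcomplex of the first
  \<open>j\<close> cells; \<open>p\<close> is the dimension of the chains they bound. The cell at
  position \<open>j\<close> is the one added in passing to \<open>Suc j\<close>.\<close>

definition chain_bnds :: "int \<Rightarrow> nat \<Rightarrow> 'c set set" where
  "chain_bnds p j = z2_span facets (cells_of p \<inter> set (take j xs))"

definition can_chain :: "int \<Rightarrow> nat \<Rightarrow> 'c set" where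
  "can_chain p j = (THE c. c \<subseteq> lower p \<and>
     (\<exists>S\<subseteq>filtered_complex.rest (take j xs) inc dim (p - 1). xsum facets c = xsum (can_cycle (p - 1)) S) \<and>
     xsum facets c \<notin> chain_bnds p j \<and> xsum facets c \<in> chain_bnds p (Suc j))"

context
  fixes pre post
  assumes xs: "xs = pre @ post"
begin

interpretation pre: filtered_complex pre inc dim
  using xs by (rule prefix_complex)

lemma prefix_facets:
  assumes "s \<in> set pre"
  shows "pre.facets s = facets s"
proof -
  obtain a b where "pre = a @ s # b" using assms by (metis split_list)
  then have "xs = a @ s # (b @ post)" "set a \<subseteq> set pre" using xs by auto
  then have "facets s \<subseteq> set pre" using facets_prefix by blast
  moreover have "set pre \<subseteq> set xs" using xs by auto
  ultimately show ?thesis unfolding pre.facets_def facets_def by blast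
qed

lemma prefix_cells_of: "pre.cells_of p = cells_of p \<inter> set pre"
proof -
  have "set pre \<subseteq> set xs" using xs by auto
  then show ?thesis unfolding pre.cells_of_def cells_of_def by blast
qed

lemma prefix_bnds: "pre.bnds p = z2_span facets (cells_of (p + 1) \<inter> set pre)"
  unfolding pre.bnds_def prefix_cells_of by (rule z2_span_cong) (simp add: prefix_facets)

lemma prefix_xsum_facets: "c \<subseteq> set pre \<Longrightarrow> xsum pre.facets c = xsum facets c"
  by (rule xsum_cong) (auto simp: prefix_facets)

text \<open>Membership in \<open>lower p\<close> depends on earlier columns only. No such statement
  holds for \<open>upper p\<close>, so \<open>rest\<close> of a prefix is in general not the
  restriction of \<open>rest\<close>.\<close>

lemma prefix_lower: "pre.lower p = lower p \<inter> set pre"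
proof (rule Set.set_eqI)
  fix s
  show "s \<in> pre.lower p \<longleftrightarrow> s \<in> lower p \<inter> set pre"
  proof (cases "s \<in> set pre")
    case True
    then obtain a b where ab: "pre = a @ s # b" by (metis split_list)
    then have xs': "xs = a @ s # (b @ post)" using xs by simp
    have "z2_span pre.facets (set a) = z2_span facets (set a)"
      using ab by (intro z2_span_cong prefix_facets) auto
    then show ?thesis
      using pre.lower_prefix_iff[OF ab] lower_prefix_iff[OF xs'] True prefix_facets by simp
  next
    case False
    then show ?thesis using pre.lower_subset pre.cells_of_subset by blast
  qed
qed

lemma prefix_cycs: "pre.cycs p = cycs p \<inter> Pow (set pre)"
  unfolding pre.cycs_def cycs_def prefix_cells_of by (auto simp: prefix_xsum_facets)

text \<open>The cycle found in the prefix also fits the characterization in the whole complex, where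
  uniqueness applies. Canonical cycles thus do not depend on the stage of the filtration.\<close>

lemma prefix_can_cycle:
  assumes s: "s \<in> pre.cells_of p - pre.lower p"
  shows "pre.can_cycle p s = can_cycle p s"
proof -
  have s': "s \<in> cells_of p - lower p" using s unfolding prefix_cells_of prefix_lower by blast
  have "pre.can_cycle p s \<in> cycs p" using pre.can_cycle(1)[OF s] unfolding prefix_cycs by blast
  moreover have "pre.can_cycle p s \<noteq> {}" "pre.can_cycle p s \<subseteq> lower p \<union> {s}"
    using pre.can_cycle(2)[OF s] unfolding prefix_lower by blast+
  ultimately show ?thesis using can_cycle_unique[OF s'] by metis
qed

lemma prefix_rest_subset: "pre.rest p \<subseteq> cells_of p - lower p"
  using pre.rest_subset[of p] unfolding prefix_cells_of prefix_lower by blast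

lemma prefix_facets_subset: "s \<in> set pre \<Longrightarrow> facets s \<subseteq> set pre"
  using pre.facets_subset prefix_facets by metis

lemma prefix_xsum_can_cycle:
  assumes "S \<subseteq> pre.rest p"
  shows "xsum (pre.can_cycle p) S = xsum (can_cycle p) S"
  using assms pre.rest_subset by (intro xsum_cong prefix_can_cycle) blast

lemma prefix_rest_bnds:
  assumes "S \<subseteq> pre.rest p" "xsum (can_cycle p) S \<in> z2_span facets (cells_of (p + 1) \<inter> set pre)"
  shows "S = {}"
  using pre.xsum_can_cycle_bnds[OF assms(1)] assms prefix_xsum_can_cycle by (simp add: prefix_bnds)

lemma prefix_cycs_mod_bnds:
  assumes "x \<in> cycs p" "x \<subseteq> set pre"
  shows "\<exists>S\<subseteq>pre.rest p. sym_diff x (xsum (can_cycle p) S) \<in> z2_span facets (cells_of (p + 1) \<inter> set pre)"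
proof -
  have "x \<in> pre.cycs p" using assms unfolding prefix_cycs by blast
  then obtain S where "S \<subseteq> pre.rest p" "sym_diff x (xsum (pre.can_cycle p) S) \<in> pre.bnds p"
    using pre.cycs_mod_bnds by blast
  then show ?thesis unfolding prefix_bnds using prefix_xsum_can_cycle by metis
qed

end

section \<open>Canonical chains and the growth of the boundary groups\<close>

lemma chain_bnds_subspace: "z2_subspace (chain_bnds p j)"
  by (simp add: chain_bnds_def z2_subspace_span)

lemma chain_bnds_mono: "i \<le> j \<Longrightarrow> chain_bnds p i \<subseteq> chain_bnds p j"
  unfolding chain_bnds_def using set_take_subset_set_take[of i j xs] by (intro z2_span_mono) blast

lemma chain_bnds_subset: "chain_bnds p j \<subseteq> bnds (p - 1)"
  unfolding chain_bnds_def bnds_def by (intro z2_span_mono) auto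

context
  fixes j :: nat and p :: int
  assumes j: "j < length xs"
begin

lemma split_at: "xs = take j xs @ xs ! j # drop (Suc j) xs"
  using j by (rule id_take_nth_drop)

lemma cells_of_take_Suc:
  "cells_of p \<inter> set (take (Suc j) xs) =
     (if dim (xs ! j) = p then insert (xs ! j) (cells_of p \<inter> set (take j xs)) else cells_of p \<inter> set (take j xs))"
  using j by (auto simp: take_Suc_conv_app_nth cells_of_def)

text \<open>Homogeneity cuts the span of all earlier columns down to dimension \<open>p\<close>: the
  cells of \<open>lower p\<close> are the \<open>p\<close>-cells that enlarge the boundary
  group.\<close>

lemma lower_iff: "xs ! j \<in> lower p \<longleftrightarrow> dim (xs ! j) = p \<and> facets (xs ! j) \<notin> chain_bnds p j"
proof -
  have "facets (xs ! j) \<in> chain_bnds p j" if "dim (xs ! j) = p" "facets (xs ! j) \<in> z2_span facets (set (take j xs))"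
    unfolding chain_bnds_def
  proof (rule z2_span_facets_cells_of[OF that(2) set_take_subset])
    show "facets (xs ! j) \<subseteq> cells_of (p - 1)"
      using that j by (intro facets_subset_cells_of) (simp add: cells_of_def)
  qed
  moreover have "chain_bnds p j \<subseteq> z2_span facets (set (take j xs))"
    unfolding chain_bnds_def by (intro z2_span_mono) blast
  ultimately show ?thesis using lower_prefix_iff[OF split_at] by blast
qed

lemma chain_bnds_diff:
  assumes "a \<in> chain_bnds p (Suc j)" "a \<notin> chain_bnds p j" "b \<in> chain_bnds p (Suc j)" "b \<notin> chain_bnds p j"
  shows "sym_diff a b \<in> chain_bnds p j"
proof -
  \<comment> \<open>A cell of any other dimension would leave \<open>chain_bnds p\<close>
    unchanged.\<close>
  have "dim (xs ! j) = p" using assms(1,2) by (auto simp: chain_bnds_def cells_of_take_Suc split: if_splits)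
  then show ?thesis
    using assms unfolding chain_bnds_def by (intro z2_span_insert_diff[of _ _ _ "xs ! j"]) (auto simp: cells_of_take_Suc)
qed

text \<open>For existence, the boundary of the new cell is a cycle of the prefix, hence homologous
  there to a sum of canonical cycles over \<open>rest\<close> of the prefix; that sum inherits being
  a boundary only after the cell is added. For uniqueness, two such sums differ by a boundary of the
  prefix, because one cell adds at most one dimension, and their index sets agree by independence in
  homology. The chains then agree because the columns of \<open>lower p\<close> are
  independent.\<close>

lemma can_chain_ex1:
  assumes low: "xs ! j \<in> lower p"
  shows "\<exists>!c. c \<subseteq> lower p \<and>
     (\<exists>S\<subseteq>filtered_complex.rest (take j xs) inc dim (p - 1). xsum facets c = xsum (can_cycle (p - 1)) S) \<and>
     xsum facets c \<notin> chain_bnds p j \<and> xsum facets c \<in> chain_bnds p (Suc j)"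
proof (rule ex_ex1I)
  let ?x = "xs ! j" and ?rest = "filtered_complex.rest (take j xs) inc dim (p - 1)"
  have x: "?x \<in> cells_of p" "?x \<in> set xs" using low lower_subset cells_of_subset by blast+
  have "facets ?x \<in> cycs (p - 1)"
    using facets_subset_cells_of[OF x(1)] xsum_facets_facets[OF x(2)] by (simp add: cycs_def)
  then obtain S where S: "S \<subseteq> ?rest" "sym_diff (facets ?x) (xsum (can_cycle (p - 1)) S) \<in> chain_bnds p j"
    using prefix_cycs_mod_bnds[OF split_at _ facets_prefix[OF split_at]]
    unfolding chain_bnds_def by (metis diff_add_cancel)
  let ?v = "xsum (can_cycle (p - 1)) S"
  have fx: "facets ?x \<notin> chain_bnds p j" using low lower_iff by blast
  have v: "?v \<notin> chain_bnds p j"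
    using z2_subspace_sym_diff_iff[OF chain_bnds_subspace, of ?v p j "facets ?x"] S(2) fx by blast
  have "facets ?x \<in> chain_bnds p (Suc j)"
    unfolding chain_bnds_def using low lower_iff by (intro z2_span_base) (simp add: cells_of_take_Suc)
  moreover have "sym_diff (facets ?x) ?v \<in> chain_bnds p (Suc j)"
    using S(2) chain_bnds_mono[of j "Suc j" p] by auto
  ultimately have "sym_diff (facets ?x) (sym_diff (facets ?x) ?v) \<in> chain_bnds p (Suc j)"
    by (rule z2_subspaceD[OF chain_bnds_subspace])
  then have v': "?v \<in> chain_bnds p (Suc j)" unfolding sym_diff_cancel_left .
  then have "?v \<in> z2_span facets (lower p)"
    using chain_bnds_subset[of p "Suc j"] z2_span_lower[of p] by (auto simp: bnds_def)
  then obtain c where "c \<subseteq> lower p" "xsum facets c = ?v" unfolding z2_span_def by blast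
  then show "\<exists>c. c \<subseteq> lower p \<and> (\<exists>S\<subseteq>?rest. xsum facets c = xsum (can_cycle (p - 1)) S) \<and>
     xsum facets c \<notin> chain_bnds p j \<and> xsum facets c \<in> chain_bnds p (Suc j)"
    using S(1) v v' by metis
next
  let ?rest = "filtered_complex.rest (take j xs) inc dim (p - 1)"
  interpret pre: filtered_complex "take j xs" inc dim using split_at by (rule prefix_complex)
  fix c d
  assume c: "c \<subseteq> lower p \<and> (\<exists>S\<subseteq>?rest. xsum facets c = xsum (can_cycle (p - 1)) S) \<and>
     xsum facets c \<notin> chain_bnds p j \<and> xsum facets c \<in> chain_bnds p (Suc j)"
  assume d: "d \<subseteq> lower p \<and> (\<exists>S\<subseteq>?rest. xsum facets d = xsum (can_cycle (p - 1)) S) \<and>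
     xsum facets d \<notin> chain_bnds p j \<and> xsum facets d \<in> chain_bnds p (Suc j)"
  obtain S T where S: "S \<subseteq> ?rest" "xsum facets c = xsum (can_cycle (p - 1)) S"
    and T: "T \<subseteq> ?rest" "xsum facets d = xsum (can_cycle (p - 1)) T" using c d by blast
  have "?rest \<subseteq> set (take j xs)" using pre.rest_subset pre.cells_of_subset by blast
  then have "S \<subseteq> set (take j xs)" "T \<subseteq> set (take j xs)" using S(1) T(1) by blast+
  then have "finite S" "finite T" by (auto intro: finite_subset)
  then have "xsum (can_cycle (p - 1)) (sym_diff S T) = sym_diff (xsum facets c) (xsum facets d)"
    unfolding S(2) T(2) by (rule xsum_sym_diff)
  moreover have "sym_diff (xsum facets c) (xsum facets d) \<in> chain_bnds p j"
    using c d chain_bnds_diff by blast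
  moreover have "sym_diff S T \<subseteq> ?rest" using S(1) T(1) by blast
  ultimately have "sym_diff S T = {}"
    using prefix_rest_bnds[OF split_at, of "sym_diff S T" "p - 1"] by (simp add: chain_bnds_def)
  then have "S = T" by (simp only: sym_diff_eq_empty)
  then have eq: "xsum facets c = xsum facets d" using S(2) T(2) by simp
  have "c \<subseteq> cells_of p" "d \<subseteq> cells_of p" using c d lower_subset by blast+
  then have "finite c" "finite d" by (auto intro: finite_subset_cells_of)
  then have "xsum facets (sym_diff c d) = {}" using eq by (simp add: xsum_sym_diff)
  moreover have "sym_diff c d \<subseteq> lower p" using c d by blast
  ultimately have "sym_diff c d = {}" using lower_independent by blast
  then show "c = d" by (simp only: sym_diff_eq_empty)
qed

lemma can_chain:
  assumes "xs ! j \<in> lower p"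
  shows "can_chain p j \<subseteq> lower p" "xsum facets (can_chain p j) \<notin> chain_bnds p j" "xsum facets (can_chain p j) \<in> chain_bnds p (Suc j)"
  using theI'[OF can_chain_ex1[OF assms]] unfolding can_chain_def by blast+

end

lemma basis_bnds:
  "z2_basis (z2_group (bnds (p - 1))) {j. j < length xs \<and> xs ! j \<in> lower p} (\<lambda>j. xsum facets (can_chain p j))"
  (is "z2_basis _ ?I ?f")
proof (rule z2_basis_z2_group[OF z2_subspace_bnds])
  show "?f ` ?I \<subseteq> bnds (p - 1)" using can_chain(3) chain_bnds_subset by blast
next
  fix S assume S: "S \<subseteq> ?I" "finite S" "xsum ?f S = {}"
  show "S = {}"
  proof (rule ccontr)
    assume "S \<noteq> {}"
    \<comment> \<open>In a relation, the term of largest position would be a boundary of the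
      preceding subcomplex.\<close>
    define j where "j = Max S"
    have j: "j \<in> S" using S \<open>S \<noteq> {}\<close> by (simp add: j_def)
    have "xsum ?f (insert j (S - {j})) = sym_diff (?f j) (xsum ?f (S - {j}))"
      using S(2) by (intro xsum_insert) auto
    then have "sym_diff (?f j) (xsum ?f (S - {j})) = {}" using S(3) j by (simp add: insert_absorb)
    then have "?f j = xsum ?f (S - {j})" by (simp only: sym_diff_eq_empty)
    moreover have "xsum ?f (S - {j}) \<in> chain_bnds p j"
    proof (rule z2_subspace_xsum[OF chain_bnds_subspace])
      show "?f ` (S - {j}) \<subseteq> chain_bnds p j"
      proof (rule image_subsetI)
        fix i assume i: "i \<in> S - {j}"
        then have "i \<le> j" "i \<noteq> j" using S(2) by (auto simp: j_def)
        then have "chain_bnds p (Suc i) \<subseteq> chain_bnds p j" by (intro chain_bnds_mono) simp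
        then show "?f i \<in> chain_bnds p j" using can_chain(3)[of i p] i S(1) by blast
      qed
    qed (use S in simp)
    ultimately show False using can_chain(2)[of j p] j S(1) by auto
  qed
next
  have span: "\<exists>S\<subseteq>?I \<inter> {..<j}. x = xsum ?f S" if "x \<in> chain_bnds p j" "j \<le> length xs" for x j
    using that
  proof (induction j arbitrary: x)
    case 0
    then show ?case by (auto simp: chain_bnds_def z2_span_def)
  next
    case (Suc j)
    then have j: "j < length xs" by simp
    show ?case
    proof (cases "x \<in> chain_bnds p j")
      case True
      then obtain S where "S \<subseteq> ?I \<inter> {..<j}" "x = xsum ?f S" using Suc.IH[of x] j by auto
      moreover from this have "S \<subseteq> ?I \<inter> {..<Suc j}" by auto
      ultimately show ?thesis by blast
    next
      case False
      have "dim (xs ! j) = p"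
        using False Suc.prems(1) by (auto simp: chain_bnds_def cells_of_take_Suc[OF j] split: if_splits)
      \<comment> \<open>Otherwise the boundary group would not grow at position \<open>j\<close>,
        although \<open>x\<close> is new there.\<close>
      moreover have "facets (xs ! j) \<notin> chain_bnds p j"
      proof
        let ?X = "cells_of p \<inter> set (take j xs)"
        assume "facets (xs ! j) \<in> chain_bnds p j"
        then have fj: "facets (xs ! j) \<in> z2_span facets ?X" by (simp add: chain_bnds_def)
        have B: "z2_subspace (z2_span facets ?X)" by (simp add: z2_subspace_span)
        have "xs ! j \<notin> ?X" using split_at[OF j] distinct_cells
          by (metis Int_iff distinct_append disjoint_iff list.set_intros(1))
        then have "chain_bnds p (Suc j) = z2_span facets ?X"
          unfolding chain_bnds_def cells_of_take_Suc[OF j]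
          using z2_span_insert[of ?X "xs ! j" facets] z2_subspace_translate_self[OF B fj] \<open>dim (xs ! j) = p\<close> by simp
        then show False using Suc.prems(1) False by (simp add: chain_bnds_def)
      qed
      ultimately have low: "xs ! j \<in> lower p" using lower_iff[OF j] by blast
      \<comment> \<open>Both \<open>x\<close> and \<open>?f j\<close> are new at position
        \<open>j\<close>, so they differ by an older boundary, to which the induction hypothesis
        applies.\<close>
      have "sym_diff x (?f j) \<in> chain_bnds p j"
        using chain_bnds_diff[OF j] Suc.prems(1) False can_chain[OF j low] by blast
      then obtain S where S: "S \<subseteq> ?I \<inter> {..<j}" "sym_diff x (?f j) = xsum ?f S"
        using Suc.IH[of "sym_diff x (?f j)"] j by auto
      have "finite S" "j \<notin> S" using S(1) finite_subset[of S "{..<j}"] by auto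
      then have "xsum ?f (insert j S) = sym_diff (?f j) (sym_diff x (?f j))" unfolding S(2) by (rule xsum_insert)
      then have "x = xsum ?f (insert j S)" by blast
      moreover have "insert j S \<subseteq> ?I \<inter> {..<Suc j}" using S(1) j low by auto
      ultimately show ?thesis by blast
    qed
  qed
  fix x assume "x \<in> bnds (p - 1)"
  moreover have "cells_of p \<inter> set xs = cells_of p" using cells_of_subset by blast
  ultimately have "x \<in> chain_bnds p (length xs)" by (simp add: bnds_def chain_bnds_def)
  then obtain S where "S \<subseteq> ?I \<inter> {..<length xs}" "x = xsum ?f S" using span[of x "length xs"] by blast
  moreover from this have "finite S" by (metis finite_Int finite_lessThan finite_subset)
  ultimately show "\<exists>S\<subseteq>?I. finite S \<and> x = xsum ?f S" by blast
qed

end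

section \<open>Ridges of polytopes\<close>

text \<open>Otherwise \<open>F \<inter> G\<close> would be a face strictly between \<open>R\<close>
  and \<open>F\<close>, whose dimensions differ by one.\<close>

lemma two_facets_Int:
  fixes P :: "'a::euclidean_space set"
  assumes P: "polytope P" and R: "R face_of P" "aff_dim R = aff_dim P - 2"
    and F: "F face_of P" "R \<subseteq> F" "aff_dim F = aff_dim P - 1"
    and G: "G face_of P" "R \<subseteq> G" "aff_dim G = aff_dim P - 1" and "F \<noteq> G"
  shows "F \<inter> G = R"
proof (rule ccontr)
  assume ne: "F \<inter> G \<noteq> R"
  have conv: "convex F" "convex G" "convex (F \<inter> G)" using F(1) G(1) by (auto intro: face_of_imp_convex convex_Int)
  have FG: "F \<inter> G face_of P" using F(1) G(1) by (rule face_of_Int)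
  have "R face_of (F \<inter> G)"
    using F(2) G(2) face_of_imp_subset[OF FG] face_of_subset[OF R(1)] by simp
  then have "aff_dim R < aff_dim (F \<inter> G)" using face_of_aff_dim_lt[OF conv(3)] ne by metis
  moreover have "F \<inter> G \<noteq> F"
  proof
    assume "F \<inter> G = F"
    then have "F \<subseteq> G" by blast
    then have "F face_of G" using F(1) face_of_imp_subset[OF G(1)] face_of_subset by blast
    then have "aff_dim F < aff_dim G" using face_of_aff_dim_lt[OF conv(2)] \<open>F \<noteq> G\<close> by metis
    then show False using F(3) G(3) by simp
  qed
  then have "aff_dim (F \<inter> G) < aff_dim F"
    using face_of_subset[OF FG _ face_of_imp_subset[OF F(1)]] face_of_aff_dim_lt[OF conv(1)] by blast
  ultimately show False using R(2) F(3) by simp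
qed

lemma face_of_polytope_supporting:
  fixes P :: "'a::euclidean_space set"
  assumes "polytope P" "F face_of P"
  obtains a b where "\<And>x. x \<in> P \<Longrightarrow> a \<bullet> x \<le> b" "\<And>x. x \<in> P \<Longrightarrow> x \<in> F \<longleftrightarrow> a \<bullet> x = b"
proof -
  have "F exposed_face_of P"
    using assms exposed_face_of_polyhedron polytope_imp_polyhedron by blast
  then obtain a b where "P \<subseteq> {x. a \<bullet> x \<le> b}" "F = P \<inter> {x. a \<bullet> x = b}"
    unfolding exposed_face_of_def by blast
  then show thesis using that by blast
qed

text \<open>
  With supporting functionals \<open>g\<^sub>i = b\<^sub>i - a\<^sub>i \<bullet> x\<close> of three such facets, some combination
  \<open>g\<^sub>3 - \<alpha> g\<^sub>1 - \<beta> g\<^sub>2\<close> with \<open>\<alpha>, \<beta> > 0\<close> vanishes on \<open>R\<close> and at a point of each of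
  the first two facets, hence on \<open>P\<close>; it is negative on the third facet outside \<open>R\<close>.
\<close>

lemma no_three_facets:
  fixes P :: "'a::euclidean_space set"
  assumes P: "polytope P" and R: "R face_of P" "aff_dim R = aff_dim P - 2"
    and F: "F face_of P" "R \<subseteq> F" "aff_dim F = aff_dim P - 1"
    and G: "G face_of P" "R \<subseteq> G" "aff_dim G = aff_dim P - 1"
    and H: "H face_of P" "R \<subseteq> H" "aff_dim H = aff_dim P - 1"
    and ne: "F \<noteq> G" "F \<noteq> H" "G \<noteq> H"
  shows False
proof -
  have FG: "F \<inter> G = R" and FH: "F \<inter> H = R" and GH: "G \<inter> H = R"
    using two_facets_Int[OF P R] F G H ne by blast+
  have sub: "F \<subseteq> P" "G \<subseteq> P" "H \<subseteq> P" "R \<subseteq> P" using F G H R face_of_imp_subset by blast+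
  have "\<not> X \<subseteq> R" if "R \<subseteq> X" "aff_dim X = aff_dim P - 1" for X
  proof
    assume "X \<subseteq> R"
    then have "X = R" using that(1) by blast
    then show False using that(2) R(2) by simp
  qed
  then obtain f g h where f: "f \<in> F" "f \<notin> R" and g: "g \<in> G" "g \<notin> R" and h: "h \<in> H" "h \<notin> R"
    using F G H by (metis subsetI)
  have mem: "f \<in> P" "g \<in> P" "h \<in> P" using f(1) g(1) h(1) sub by auto
  have notmem: "f \<notin> G" "g \<notin> F" "f \<notin> H" "h \<notin> F" "g \<notin> H" "h \<notin> G"
    using f g h FG FH GH by (metis IntI)+
  obtain a1 b1 where 1: "\<And>x. x \<in> P \<Longrightarrow> a1 \<bullet> x \<le> b1" "\<And>x. x \<in> P \<Longrightarrow> x \<in> F \<longleftrightarrow> a1 \<bullet> x = b1"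
    using face_of_polytope_supporting[OF P F(1)] by blast
  obtain a2 b2 where 2: "\<And>x. x \<in> P \<Longrightarrow> a2 \<bullet> x \<le> b2" "\<And>x. x \<in> P \<Longrightarrow> x \<in> G \<longleftrightarrow> a2 \<bullet> x = b2"
    using face_of_polytope_supporting[OF P G(1)] by blast
  obtain a3 b3 where 3: "\<And>x. x \<in> P \<Longrightarrow> a3 \<bullet> x \<le> b3" "\<And>x. x \<in> P \<Longrightarrow> x \<in> H \<longleftrightarrow> a3 \<bullet> x = b3"
    using face_of_polytope_supporting[OF P H(1)] by blast
  have R0: "a1 \<bullet> x = b1" "a2 \<bullet> x = b2" "a3 \<bullet> x = b3" if "x \<in> R" for x
    using that 1(2)[of x] 2(2)[of x] 3(2)[of x] F(2) G(2) H(2) sub(4) by auto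
  have f0: "a1 \<bullet> f = b1" "a2 \<bullet> f < b2" "a3 \<bullet> f < b3"
    using 1 2 3 mem notmem f(1) by (auto simp: less_le)
  have g0: "a2 \<bullet> g = b2" "a1 \<bullet> g < b1" "a3 \<bullet> g < b3"
    using 1 2 3 mem notmem g(1) by (auto simp: less_le)
  have h0: "a3 \<bullet> h = b3" "a1 \<bullet> h < b1" "a2 \<bullet> h < b2"
    using 1 2 3 mem notmem h(1) by (auto simp: less_le)
  \<comment> \<open>\<open>f\<close> and \<open>g\<close> raise the dimension of \<open>R\<close> by
    one each, and so complete it to an affine spanning set of \<open>P\<close>: the functional of
    \<open>G\<close> vanishes on \<open>R\<close> but not at \<open>f\<close>, that of
    \<open>F\<close> vanishes on \<open>R\<close> and \<open>f\<close> but not at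
    \<open>g\<close>.\<close>
  have "R \<subseteq> {x. a2 \<bullet> x = b2}" using R0 by blast
  then have "affine hull R \<subseteq> {x. a2 \<bullet> x = b2}" using affine_hyperplane by (rule hull_minimal)
  then have "f \<notin> affine hull R" using f0 by auto
  then have dim1: "aff_dim (insert f R) = aff_dim R + 1" by (simp add: aff_dim_insert)
  have "insert f R \<subseteq> {x. a1 \<bullet> x = b1}" using R0 f0 by blast
  then have "affine hull (insert f R) \<subseteq> {x. a1 \<bullet> x = b1}" using affine_hyperplane by (rule hull_minimal)
  then have "g \<notin> affine hull (insert f R)" using g0 by auto
  then have "aff_dim (insert g (insert f R)) = aff_dim P" using dim1 R(2) by (simp add: aff_dim_insert)
  moreover have "insert g (insert f R) \<subseteq> P" using mem sub by blast
  ultimately have hull: "affine hull (insert g (insert f R)) = affine hull P"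
    by (intro affine_dim_equal hull_mono affine_affine_hull) (auto simp: hull_inc)
  \<comment> \<open>At \<open>g\<close> the functional of \<open>G\<close> vanishes, so matching the
    functional of \<open>H\<close> there fixes \<alpha>; at \<open>f\<close> that of
    \<open>F\<close> vanishes, which fixes \<beta>.\<close>
  define \<alpha> where "\<alpha> = (b3 - a3 \<bullet> g) / (b1 - a1 \<bullet> g)"
  define \<beta> where "\<beta> = (b3 - a3 \<bullet> f) / (b2 - a2 \<bullet> f)"
  have pos: "\<alpha> > 0" "\<beta> > 0" using f0 g0 by (simp_all add: \<alpha>_def \<beta>_def)
  have eqs: "\<alpha> * (b1 - a1 \<bullet> g) = b3 - a3 \<bullet> g" "\<beta> * (b2 - a2 \<bullet> f) = b3 - a3 \<bullet> f"
    using f0 g0 by (simp_all add: \<alpha>_def \<beta>_def)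
  let ?A = "a3 - \<alpha> *\<^sub>R a1 - \<beta> *\<^sub>R a2" and ?b = "b3 - \<alpha> * b1 - \<beta> * b2"
  have "insert g (insert f R) \<subseteq> {x. ?A \<bullet> x = ?b}"
    using R0 f0 g0 eqs by (auto simp: inner_diff_left algebra_simps)
  then have "affine hull (insert g (insert f R)) \<subseteq> {x. ?A \<bullet> x = ?b}"
    using affine_hyperplane by (rule hull_minimal)
  then have "?A \<bullet> h = ?b" using hull mem(3) by (auto simp: hull_inc)
  then have "\<alpha> * (b1 - a1 \<bullet> h) + \<beta> * (b2 - a2 \<bullet> h) = 0"
    using h0 by (simp add: inner_diff_left algebra_simps)
  moreover have "\<alpha> * (b1 - a1 \<bullet> h) > 0" "\<beta> * (b2 - a2 \<bullet> h) > 0" using pos h0 by simp_all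
  ultimately show False by simp
qed

text \<open>A non-empty proper face is the intersection of the facets containing it, and a single
  facet would have too large a dimension. The empty ridge is treated apart: \<open>P\<close> is then
  a segment, and its facets are its end points.\<close>

lemma two_facets_exist:
  fixes P :: "'a::euclidean_space set"
  assumes P: "polytope P" and R: "R face_of P" "aff_dim R = aff_dim P - 2"
  shows "\<exists>F G. F \<noteq> G \<and> F face_of P \<and> R \<subseteq> F \<and> aff_dim F = aff_dim P - 1 \<and>
     G face_of P \<and> R \<subseteq> G \<and> aff_dim G = aff_dim P - 1"
proof (cases "R = {}")
  case True
  then have d: "aff_dim P = 1" using R(2) by simp
  let ?E = "{x. x extreme_point_of P}"
  have E: "P = convex hull ?E"
    using P by (intro Krein_Milman_Minkowski polytope_imp_compact polytope_imp_convex)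
  have "\<not> ?E \<subseteq> {v}" for v
  proof
    assume "?E \<subseteq> {v}"
    then have "P \<subseteq> {v}" using E hull_mono[of ?E "{v}" convex] by simp
    then have "aff_dim P \<le> 0" using aff_dim_subset[of P "{v}"] by simp
    then show False using d by simp
  qed
  then obtain x y where xy: "x extreme_point_of P" "y extreme_point_of P" "x \<noteq> y" by blast
  then have "{x} face_of P" "{y} face_of P" by (simp_all add: face_of_singleton)
  then show ?thesis using xy(3) True d by (intro exI[of _ "{x}"] exI[of _ "{y}"]) auto
next
  case False
  have "R \<noteq> P" using R(2) by auto
  then have eq: "R = \<Inter>{F. F facet_of P \<and> R \<subseteq> F}"
    using face_of_polyhedron[OF polytope_imp_polyhedron[OF P] R(1) False] by blast
  let ?S = "{F. F facet_of P \<and> R \<subseteq> F}"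
  \<comment> \<open>The intersection of no facets is the whole space.\<close>
  have "?S \<noteq> {}" using eq \<open>R \<noteq> P\<close> face_of_imp_subset[OF R(1)] by (metis Inter_empty top.extremum_uniqueI)
  then obtain F where F: "F \<in> ?S" by blast
  have "?S \<noteq> {F}"
  proof
    assume "?S = {F}"
    then have "R = F" using eq by (metis cInf_singleton)
    then show False using F R(2) by (simp add: facet_of_def)
  qed
  then obtain G where "G \<in> ?S" "G \<noteq> F" using F by blast
  then show ?thesis using F unfolding facet_of_def by blast
qed

lemma card_facets_containing_ridge:
  fixes P :: "'a::euclidean_space set"
  assumes P: "polytope P" and R: "R face_of P" "aff_dim R = aff_dim P - 2"
  shows "card {F. F face_of P \<and> R \<subseteq> F \<and> aff_dim F = aff_dim P - 1} = 2"
proof -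
  obtain F G where FG: "F \<noteq> G" "F face_of P" "R \<subseteq> F" "aff_dim F = aff_dim P - 1"
     "G face_of P" "R \<subseteq> G" "aff_dim G = aff_dim P - 1"
    using two_facets_exist[OF P R] by blast
  have "H = F \<or> H = G" if "H face_of P" "R \<subseteq> H" "aff_dim H = aff_dim P - 1" for H
    using no_three_facets[OF P R FG(2-7) that FG(1)] by blast
  then have "{F. F face_of P \<and> R \<subseteq> F \<and> aff_dim F = aff_dim P - 1} = {F, G}"
    using FG by blast
  then show ?thesis using FG(1) by simp
qed

section \<open>The boundary matrix of a polyhedral complex\<close>

lemma z2_span_image_iff:
  assumes h: "inj_on h Y" and X: "finite X" and f: "\<And>x. x \<in> X \<Longrightarrow> f x \<subseteq> Y" and v: "v \<subseteq> Y"
  shows "h ` v \<in> z2_span (\<lambda>x. h ` f x) X \<longleftrightarrow> v \<in> z2_span f X"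
proof -
  have "h ` v = xsum (\<lambda>x. h ` f x) S \<longleftrightarrow> v = xsum f S" if "S \<subseteq> X" for S
  proof -
    have "finite S" using that X by (rule finite_subset)
    then have "xsum (\<lambda>x. h ` f x) S = h ` xsum f S"
      using image_xsum[OF h, of S f] f that by auto
    moreover have "xsum f S \<subseteq> Y" using f that by (intro xsum_subset) auto
    ultimately show ?thesis using inj_on_image_eq_iff[OF h v] by simp
  qed
  then show ?thesis unfolding z2_span_def by (auto simp: image_iff)
qed

lemma z2_span_reindex:
  assumes "inj_on h X"
  shows "z2_span f (h ` X) = z2_span (\<lambda>x. f (h x)) X"
proof -
  have *: "xsum f (h ` S) = xsum (\<lambda>x. f (h x)) S" if "S \<in> Pow X" for S
    using that assms by (intro xsum_image) (auto intro: inj_on_subset)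
  have "z2_span f (h ` X) = (\<lambda>S. xsum f (h ` S)) ` Pow X"
    unfolding z2_span_def image_Pow_surj[OF refl, symmetric] image_image ..
  also have "\<dots> = (\<lambda>S. xsum (\<lambda>x. f (h x)) S) ` Pow X" using * by (rule image_cong[OF refl])
  finally show ?thesis by (simp add: z2_span_def)
qed

lemma z2_basis_reindex:
  assumes b: "z2_basis G I f" and r: "inj_on r J" "r ` J = I" and g: "\<And>j. j \<in> J \<Longrightarrow> g j = f (r j)"
  shows "z2_basis G J g"
proof -
  have G: "z2_vector_space G" and f: "f ` I \<subseteq> carrier G"
    and indep: "\<And>S. \<lbrakk>S \<subseteq> I; finite S; finprod G f S = \<one>\<^bsub>G\<^esub>\<rbrakk> \<Longrightarrow> S = {}"
    and span: "\<And>x. x \<in> carrier G \<Longrightarrow> \<exists>S\<subseteq>I. finite S \<and> x = finprod G f S"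
    using b unfolding z2_basis_def by auto
  interpret comm_group G using G by (simp add: z2_vector_space_def)
  have *: "finprod G g S = finprod G f (r ` S)" if "S \<subseteq> J" for S
  proof -
    have "f \<in> r ` S \<rightarrow> carrier G" using f r(2) that by auto
    then have "finprod G f (r ` S) = finprod G (\<lambda>j. f (r j)) S"
      using r(1) that by (intro finprod_reindex) (auto intro: inj_on_subset)
    moreover have "f (r x) \<in> carrier G" if "x \<in> S" for x using f r(2) that \<open>S \<subseteq> J\<close> by blast
    then have "finprod G g S = finprod G (\<lambda>j. f (r j)) S"
      using g that by (intro finprod_cong') auto
    ultimately show ?thesis by simp
  qed
  have "g ` J \<subseteq> carrier G" using f g r(2) by auto
  moreover have "S = {}" if "S \<subseteq> J" "finite S" "finprod G g S = \<one>\<^bsub>G\<^esub>" for S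
  proof -
    have "r ` S \<subseteq> I" "finite (r ` S)" "finprod G f (r ` S) = \<one>\<^bsub>G\<^esub>" using that r(2) * by auto
    then have "r ` S = {}" by (rule indep)
    then show ?thesis by simp
  qed
  moreover have "\<exists>S\<subseteq>J. finite S \<and> x = finprod G g S" if x: "x \<in> carrier G" for x
  proof -
    obtain T where T: "T \<subseteq> I" "finite T" "x = finprod G f T" using span[OF x] by blast
    then obtain S where "S \<subseteq> J" "T = r ` S" using r(2) by (metis subset_imageE)
    moreover from this have "finite S" using T(2) r(1) by (metis finite_imageD inj_on_subset)
    ultimately show ?thesis using T(3) * by metis
  qed
  ultimately show ?thesis using G unfolding z2_basis_def by blast
qed

text \<open>Indices are not bounded by the size of the matrix, so that passing to supports is a
  bijection, as the locale \<open>reduction\<close> demands.\<close>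

definition column_support :: "bit_matrix \<Rightarrow> nat \<Rightarrow> nat set" where
  "column_support R j = {i. R i j \<noteq> 0}"

definition row_support :: "bit_matrix \<Rightarrow> nat \<Rightarrow> nat set" where
  "row_support Q i = {j. Q i j \<noteq> 0}"

lemma bij_column_support: "bij column_support"
proof (rule bijI)
  show "inj column_support"
  proof (rule injI, rule ext, rule ext)
    fix R R' i j assume "column_support R = column_support R'"
    then have "i \<in> column_support R j \<longleftrightarrow> i \<in> column_support R' j" by simp
    then show "R i j = R' i j" by (cases "R i j"; cases "R' i j"; simp add: column_support_def)
  qed
  have "column_support (\<lambda>i j. of_bool (i \<in> V j)) = V" for V by (simp add: column_support_def fun_eq_iff)
  then show "surj column_support" by (metis surj_def)
qed

lemma bij_row_support: "bij row_support"
proof (rule bijI)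
  show "inj row_support"
  proof (rule injI, rule ext, rule ext)
    fix R R' i j assume "row_support R = row_support R'"
    then have "j \<in> row_support R i \<longleftrightarrow> j \<in> row_support R' i" by simp
    then show "R i j = R' i j" by (cases "R i j"; cases "R' i j"; simp add: row_support_def)
  qed
  have "row_support (\<lambda>i j. of_bool (j \<in> V i)) = V" for V by (simp add: row_support_def fun_eq_iff)
  then show "surj row_support" by (metis surj_def)
qed

lemma column_support_add_column:
  "column_support (add_column l j R) =
     (column_support R)(j := sym_diff (column_support R j) (column_support R l))"
proof (rule ext, rule Set.set_eqI)
  fix k i
  show "i \<in> column_support (add_column l j R) k \<longleftrightarrow>
     i \<in> ((column_support R)(j := sym_diff (column_support R j) (column_support R l))) k"
    by (cases "k = j"; cases "R i j"; cases "R i l"; simp add: column_support_def add_column_def)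
qed

lemma row_support_add_row:
  "row_support (add_row l i Q) = (row_support Q)(i := sym_diff (row_support Q i) (row_support Q l))"
proof (rule ext, rule Set.set_eqI)
  fix k j
  show "j \<in> row_support (add_row l i Q) k \<longleftrightarrow>
     j \<in> ((row_support Q)(i := sym_diff (row_support Q i) (row_support Q l))) k"
    by (cases "k = i"; cases "Q i j"; cases "Q l j"; simp add: row_support_def add_row_def)
qed

lemma upt_eq_append_ConsD:
  assumes "[0..<n] = pre @ j # post"
  shows "set pre = {..<j} \<and> set post = {j<..<n}"
proof -
  have len: "length pre < n" using arg_cong[OF assms, of length] by simp
  have "j = [0..<n] ! length pre" using assms by simp
  then have j: "j = length pre" "j < n" using len by simp_all
  have "pre = take j [0..<n]" using assms j(1) by simp
  moreover have "post = drop (Suc j) [0..<n]" using assms j(1) by simp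
  ultimately show ?thesis using j(2) by auto
qed

definition lowest :: "nat \<Rightarrow> nat set \<Rightarrow> nat option" where
  "lowest n v = (if v \<inter> {..<n} = {} then None else Some (Max (v \<inter> {..<n})))"

definition leftmost :: "nat \<Rightarrow> nat set \<Rightarrow> nat option" where
  "leftmost n v = (if v \<inter> {..<n} = {} then None else Some (Min (v \<inter> {..<n})))"

lemma low_eq_lowest: "low n R l = lowest n (column_support R l)"
proof -
  have "{i. i < n \<and> R i l \<noteq> 0} = column_support R l \<inter> {..<n}" by (auto simp: column_support_def)
  moreover have "(\<forall>i<n. R i l = 0) \<longleftrightarrow> column_support R l \<inter> {..<n} = {}" by (auto simp: column_support_def)
  ultimately show ?thesis by (simp add: low_def lowest_def)
qed

lemma left_eq_leftmost: "left n Q l = leftmost n (row_support Q l)"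
proof -
  have "{j. j < n \<and> Q l j \<noteq> 0} = row_support Q l \<inter> {..<n}" by (auto simp: row_support_def)
  moreover have "(\<forall>j<n. Q l j = 0) \<longleftrightarrow> row_support Q l \<inter> {..<n} = {}" by (auto simp: row_support_def)
  ultimately show ?thesis by (simp add: left_def leftmost_def)
qed

lemma column_reduction:
  "reduction n [0..<n] lessThan id (lowest n) column_support (column_step n)"
proof
  fix pre j post assume "[0..<n] = pre @ j # post"
  then show "{..<j} = set pre" using upt_eq_append_ConsD by blast
next
  fix v i assume v: "v \<subseteq> {..<n}" "lowest n v = Some i"
  then have "v \<inter> {..<n} = v" "finite v" using finite_subset by auto
  then have "v \<noteq> {}" "i = Max v" using v(2) by (auto simp: lowest_def split: if_splits)
  then show "i \<in> v \<and> (\<forall>k\<in>v. id k \<le> id i)" using \<open>finite v\<close> by simp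
next
  fix j R R'
  show "column_step n j R R' \<longleftrightarrow> (\<exists>l\<in>{..<j}. \<exists>i. lowest n (column_support R l) = Some i \<and>
      i \<in> column_support R j \<and>
      column_support R' = (column_support R)(j := sym_diff (column_support R j) (column_support R l)))"
    unfolding column_step_def low_eq_lowest column_support_add_column[symmetric]
      inj_eq[OF bij_is_inj[OF bij_column_support]]
    by (auto simp: column_support_def)
qed (auto simp: lowest_def bij_column_support)

text \<open>The rank is \<open>n - i\<close> because the leftmost entry, which is the pivot of a
  row, must have the largest rank.\<close>

lemma row_reduction:
  "reduction n (rev [0..<n]) (\<lambda>i. {i<..<n}) (\<lambda>i. n - i) (leftmost n) row_support (row_step n)"
proof
  fix pre i post assume "rev [0..<n] = pre @ i # post"
  then have "[0..<n] = rev post @ i # rev pre" unfolding rev_eq_append_Cons_iff .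
  then show "{i<..<n} = set pre" using upt_eq_append_ConsD by (metis set_rev)
next
  show "inj_on (\<lambda>i. n - i) {..<n}" by (auto simp: inj_on_def)
next
  fix v i assume v: "v \<subseteq> {..<n}" "leftmost n v = Some i"
  then have "v \<inter> {..<n} = v" "finite v" using finite_subset by auto
  then have "v \<noteq> {}" "i = Min v" using v(2) by (auto simp: leftmost_def split: if_splits)
  then show "i \<in> v \<and> (\<forall>k\<in>v. n - k \<le> n - i)" using \<open>finite v\<close> by (simp add: diff_le_mono2)
next
  fix i Q Q'
  show "row_step n i Q Q' \<longleftrightarrow> (\<exists>l\<in>{i<..<n}. \<exists>j. leftmost n (row_support Q l) = Some j \<and>
      j \<in> row_support Q i \<and>
      row_support Q' = (row_support Q)(i := sym_diff (row_support Q i) (row_support Q l)))"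
    unfolding row_step_def left_eq_leftmost row_support_add_row[symmetric]
      inj_eq[OF bij_is_inj[OF bij_row_support]]
    by (auto simp: row_support_def)
qed (auto simp: leftmost_def bij_row_support)

definition facet_incidence :: "'a::euclidean_space set \<Rightarrow> 'a set \<Rightarrow> bool" where
  "facet_incidence t s \<longleftrightarrow> t \<subseteq> s \<and> aff_dim t = aff_dim s - 1"

text \<open>Kept apart from polyhedral complexes because the tri-partition is also taken of
  suffixes, which lack the empty cell and need not be closed under faces.\<close>

locale incidence_complex = filtered_complex xs facet_incidence aff_dim
  for xs :: "'a::euclidean_space set list"
begin

abbreviation "n \<equiv> length xs"

lemma inj_nth: "inj_on ((!) xs) {..<n}"
  using distinct_cells by (simp add: inj_on_nth)

lemma image_column_support: "l < n \<Longrightarrow> (!) xs ` column_support (boundary_matrix xs) l = facets (xs ! l)"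
  by (auto simp: column_support_def boundary_matrix_def facets_def facet_incidence_def image_iff in_set_conv_nth)

lemma image_row_support: "l < n \<Longrightarrow> (!) xs ` row_support (boundary_matrix xs) l = cofacets (xs ! l)"
  by (auto simp: row_support_def boundary_matrix_def cofacets_def facet_incidence_def image_iff in_set_conv_nth)

lemma column_support_bounded: "column_support (boundary_matrix xs) l \<subseteq> {..<n}"
  by (auto simp: column_support_def boundary_matrix_def)

lemma row_support_bounded: "row_support (boundary_matrix xs) l \<subseteq> {..<n}"
  by (auto simp: row_support_def boundary_matrix_def)

lemma z2_span_nth:
  assumes X: "X \<subseteq> {..<n}" and V: "\<And>l. V l \<subseteq> {..<n}" "\<And>l. l < n \<Longrightarrow> (!) xs ` V l = f (xs ! l)"
    and j: "j < n"
  shows "V j \<in> z2_span V X \<longleftrightarrow> f (xs ! j) \<in> z2_span f ((!) xs ` X)"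
proof -
  have "finite X" using X finite_subset by blast
  have "z2_span f ((!) xs ` X) = z2_span (\<lambda>l. f (xs ! l)) X"
    using inj_on_subset[OF inj_nth X] by (rule z2_span_reindex)
  also have "\<dots> = z2_span (\<lambda>l. (!) xs ` V l) X" by (rule z2_span_cong) (use V(2) X in auto)
  finally show ?thesis
    using z2_span_image_iff[OF inj_nth \<open>finite X\<close> V(1) V(1), of j] V(2)[OF j] by simp
qed

lemma column_reduced_nonzero_iff:
  assumes j: "j < n"
  shows "(\<exists>i<n. column_reduced xs i j \<noteq> 0) \<longleftrightarrow> facets (xs ! j) \<notin> z2_span facets (set (take j xs))"
proof -
  interpret red: reduction n "[0..<n]" lessThan id "lowest n" column_support "column_step n"
    by (rule column_reduction)
  have "red.bounded (boundary_matrix xs)" using column_support_bounded by (simp add: red.bounded_def)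
  then have R: "red.reduced_prefix (boundary_matrix xs) [0..<n] (column_reduced xs)"
    unfolding column_reduced_def by (rule red.reduction_correct)
  then have "column_support (column_reduced xs) j \<subseteq> {..<n}"
    by (simp add: red.reduced_prefix_def red.bounded_def)
  then have "(\<exists>i<n. column_reduced xs i j \<noteq> 0) \<longleftrightarrow> column_support (column_reduced xs) j \<noteq> {}"
    by (auto simp: column_support_def)
  also have "\<dots> \<longleftrightarrow> column_support (boundary_matrix xs) j \<notin> z2_span (column_support (boundary_matrix xs)) {..<j}"
    using R j by (simp add: red.reduced_prefix_def)
  also have "\<dots> \<longleftrightarrow> facets (xs ! j) \<notin> z2_span facets ((!) xs ` {..<j})"
    using z2_span_nth[of "{..<j}" "column_support (boundary_matrix xs)" facets j]
      column_support_bounded image_column_support j by simp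
  also have "(!) xs ` {..<j} = set (take j xs)"
    using j by (simp add: nth_image lessThan_atLeast0)
  finally show ?thesis .
qed

lemma greaterThanLessThan_subset: "{i<..<n} \<subseteq> {..<n}"
  by auto

lemma row_reduced_nonzero_iff:
  assumes i: "i < n"
  shows "(\<exists>j<n. row_reduced xs i j \<noteq> 0) \<longleftrightarrow> cofacets (xs ! i) \<notin> z2_span cofacets (set (drop (Suc i) xs))"
proof -
  interpret red: reduction n "rev [0..<n]" "\<lambda>i. {i<..<n}" "\<lambda>i. n - i" "leftmost n" row_support "row_step n"
    by (rule row_reduction)
  have "red.bounded (boundary_matrix xs)" using row_support_bounded by (simp add: red.bounded_def)
  then have R: "red.reduced_prefix (boundary_matrix xs) (rev [0..<n]) (row_reduced xs)"
    unfolding row_reduced_def by (rule red.reduction_correct)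
  then have "row_support (row_reduced xs) i \<subseteq> {..<n}"
    by (simp add: red.reduced_prefix_def red.bounded_def)
  then have "(\<exists>j<n. row_reduced xs i j \<noteq> 0) \<longleftrightarrow> row_support (row_reduced xs) i \<noteq> {}"
    by (auto simp: row_support_def)
  also have "\<dots> \<longleftrightarrow> row_support (boundary_matrix xs) i \<notin> z2_span (row_support (boundary_matrix xs)) {i<..<n}"
    using R i by (simp add: red.reduced_prefix_def)
  also have "\<dots> \<longleftrightarrow> cofacets (xs ! i) \<notin> z2_span cofacets ((!) xs ` {i<..<n})"
    by (simp only: z2_span_nth[of "{i<..<n}" "row_support (boundary_matrix xs)" cofacets i,
          OF greaterThanLessThan_subset row_support_bounded image_row_support i])
  also have "(!) xs ` {i<..<n} = set (drop (Suc i) xs)"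
  proof -
    have "set (drop (Suc i) xs) = (!) (drop (Suc i) xs) ` {0..<n - Suc i}"
      using nth_image[of "n - Suc i" "drop (Suc i) xs"] by simp
    also have "\<dots> = (\<lambda>k. xs ! (Suc i + k)) ` {0..<n - Suc i}" by (rule image_cong) auto
    also have "\<dots> = (!) xs ` (+) (Suc i) ` {0..<n - Suc i}" by (simp only: image_image)
    also have "(+) (Suc i) ` {0..<n - Suc i} = {i<..<n}"
      by (simp only: image_add_atLeastLessThan) (use i in auto)
    finally show ?thesis by simp
  qed
  finally show ?thesis .
qed

lemma ex_split_iff: "(\<exists>pre post. xs = pre @ s # post \<and> P pre post) \<longleftrightarrow>
    (\<exists>j<n. s = xs ! j \<and> P (take j xs) (drop (Suc j) xs))"
proof
  assume "\<exists>pre post. xs = pre @ s # post \<and> P pre post"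
  then obtain pre post where *: "xs = pre @ s # post" "P pre post" by blast
  then have "length pre < n" "s = xs ! length pre" "take (length pre) xs = pre" "drop (Suc (length pre)) xs = post"
    by simp_all
  with *(2) show "\<exists>j<n. s = xs ! j \<and> P (take j xs) (drop (Suc j) xs)" by metis
next
  assume "\<exists>j<n. s = xs ! j \<and> P (take j xs) (drop (Suc j) xs)"
  then show "\<exists>pre post. xs = pre @ s # post \<and> P pre post" using id_take_nth_drop by metis
qed

lemma tri_lower_eq: "tri_lower xs p = lower p"
proof (rule Set.set_eqI)
  fix s
  have "s \<in> lower p \<longleftrightarrow> (\<exists>j<n. s = xs ! j \<and> (aff_dim s = p \<and> facets s \<notin> z2_span facets (set (take j xs))))"
    unfolding lower_def mem_Collect_eq by (rule ex_split_iff)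
  also have "\<dots> \<longleftrightarrow> (\<exists>j. s = xs ! j \<and> j < n \<and> aff_dim (xs ! j) = p \<and> (\<exists>i<n. column_reduced xs i j \<noteq> 0))"
    using column_reduced_nonzero_iff by metis
  also have "\<dots> \<longleftrightarrow> s \<in> tri_lower xs p" by (simp only: tri_lower_def mem_Collect_eq)
  finally show "s \<in> tri_lower xs p \<longleftrightarrow> s \<in> lower p" ..
qed

lemma tri_upper_eq: "tri_upper xs p = upper p"
proof (rule Set.set_eqI)
  fix s
  have "s \<in> upper p \<longleftrightarrow> (\<exists>j<n. s = xs ! j \<and> (aff_dim s = p \<and> cofacets s \<notin> z2_span cofacets (set (drop (Suc j) xs))))"
    unfolding upper_def mem_Collect_eq by (rule ex_split_iff)
  also have "\<dots> \<longleftrightarrow> (\<exists>j. s = xs ! j \<and> j < n \<and> aff_dim (xs ! j) = p \<and> (\<exists>i<n. row_reduced xs j i \<noteq> 0))"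
    using row_reduced_nonzero_iff by metis
  also have "\<dots> \<longleftrightarrow> s \<in> tri_upper xs p" by (simp only: tri_upper_def mem_Collect_eq)
  finally show "s \<in> tri_upper xs p \<longleftrightarrow> s \<in> upper p" ..
qed

lemma tri_rest_eq: "tri_rest xs p = rest p"
  unfolding tri_rest_def rest_def tri_lower_eq tri_upper_eq cells_def cells_of_def ..

end

text \<open>The boundary matrix is defined through inclusion, \<open>bdry\<close> and
  \<open>cobdry\<close> through faces. Cells meet in common faces, so the two agree.\<close>

lemma polyhedral_complex_subset_face_of:
  assumes "polyhedral_complex K" "S \<in> K" "T \<in> K"
  shows "S \<subseteq> T \<longleftrightarrow> S face_of T"
proof
  assume "S \<subseteq> T"
  then have "S \<inter> T = S" by blast
  moreover have "S \<inter> T face_of T" using assms by (simp add: polyhedral_complex_def)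
  ultimately show "S face_of T" by simp
qed (rule face_of_imp_subset)

lemma filtered_complex_polyhedral:
  assumes K: "polyhedral_complex K" and \<sigma>: "monotonic_ordering K \<sigma>"
  shows "filtered_complex \<sigma> facet_incidence aff_dim"
proof
  have set: "set \<sigma> = K" and dist: "distinct \<sigma>" using \<sigma> by (auto simp: monotonic_ordering_def)
  show "distinct \<sigma>" by (fact dist)
  fix t s assume "t \<in> set \<sigma>" "s \<in> set \<sigma>" "facet_incidence t s"
  then show "aff_dim t = aff_dim s - 1" by (simp add: facet_incidence_def)
next
  have set: "set \<sigma> = K" and dist: "distinct \<sigma>" using \<sigma> by (auto simp: monotonic_ordering_def)
  fix pre s post t assume *: "\<sigma> = pre @ s # post" "t \<in> set \<sigma>" "facet_incidence t s"
  from *(2) obtain i where i: "i < length \<sigma>" "\<sigma> ! i = t" unfolding in_set_conv_nth by blast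
  have s: "\<sigma> ! length pre = s" "length pre < length \<sigma>" using *(1) by simp_all
  have "s \<in> K" using s set by (metis nth_mem)
  then have "t face_of s"
    using polyhedral_complex_subset_face_of[OF K] * set by (auto simp: facet_incidence_def)
  then have "i \<le> length pre" using \<sigma> i s unfolding monotonic_ordering_def by blast
  moreover have "i \<noteq> length pre" using i s *(3) by (auto simp: facet_incidence_def)
  ultimately have "i < length pre" by simp
  then have "t = pre ! i" using i(2) *(1) by (simp add: nth_append)
  then show "t \<in> set pre" using \<open>i < length pre\<close> by simp
next
  have set: "set \<sigma> = K" using \<sigma> by (auto simp: monotonic_ordering_def)
  fix u s assume us: "u \<in> set \<sigma>" "s \<in> set \<sigma>"
  let ?T = "{t \<in> set \<sigma>. facet_incidence u t \<and> facet_incidence t s}"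
  show "even (card ?T)"
  \<comment> \<open>Only a pair of codimension two can have cells in between. These are then the two
    facets of \<open>s\<close> through the ridge \<open>u\<close>, and closure under faces puts both
    into \<open>K\<close>. If \<open>s\<close> is an edge, \<open>u\<close> is the empty
    cell.\<close>
  proof (cases "u \<subseteq> s \<and> aff_dim u = aff_dim s - 2")
    case True
    have "polytope s" "u face_of s"
      using K us set True polyhedral_complex_subset_face_of[OF K] by (auto simp: polyhedral_complex_def)
    then have "card {F. F face_of s \<and> u \<subseteq> F \<and> aff_dim F = aff_dim s - 1} = 2"
      using True by (intro card_facets_containing_ridge) auto
    moreover have "?T = {F. F face_of s \<and> u \<subseteq> F \<and> aff_dim F = aff_dim s - 1}"
    proof (rule Set.set_eqI)
      fix F
      have "F face_of s \<Longrightarrow> F \<in> K" using K us set by (auto simp: polyhedral_complex_def)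
      then show "F \<in> ?T \<longleftrightarrow> F \<in> {F. F face_of s \<and> u \<subseteq> F \<and> aff_dim F = aff_dim s - 1}"
        using polyhedral_complex_subset_face_of[OF K, of F s] us set True by (auto simp: facet_incidence_def)
    qed
    ultimately show ?thesis by simp
  next
    case False
    then have "?T = {}" by (auto simp: facet_incidence_def)
    then show ?thesis by (simp only: card.empty even_zero)
  qed
qed

section \<open>Canonical bases\<close>

locale ordered_polyhedral_complex =
  fixes K :: "'a::euclidean_space set set" and \<sigma> :: "'a set list"
  assumes complex: "polyhedral_complex K" and ordering: "monotonic_ordering K \<sigma>"
begin

sublocale primal: incidence_complex \<sigma>
  by (intro incidence_complex.intro filtered_complex_polyhedral[OF complex ordering])

text \<open>Cohomology is the homology of this instance: cochains of dimension \<open>p\<close> are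
  its chains of dimension \<open>- p\<close>.\<close>

sublocale dual: filtered_complex "rev \<sigma>" "\<lambda>t s. facet_incidence s t" "\<lambda>s. - aff_dim s"
  by (rule primal.dual)

lemma set_ordering: "set \<sigma> = K"
  using ordering by (simp add: monotonic_ordering_def)

lemma cells_eq: "cells K p = primal.cells_of p"
  by (simp add: cells_def primal.cells_of_def set_ordering)

lemma cells_eq_dual: "cells K p = dual.cells_of (- p)"
  by (simp add: cells_eq primal.dual_cells_of)

lemma bdry_eq:
  assumes Y: "Y \<subseteq> K" and c: "c \<subseteq> cells K p"
  shows "bdry Y p c = xsum primal.facets c \<inter> Y"
proof (rule Set.set_eqI)
  fix T
  show "T \<in> bdry Y p c \<longleftrightarrow> T \<in> xsum primal.facets c \<inter> Y"
  proof (cases "T \<in> Y \<and> aff_dim T = p - 1")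
    case True
    have "T face_of S \<longleftrightarrow> T \<in> primal.facets S" if "S \<in> c" for S
    proof -
      have "S \<in> K" "aff_dim S = p" "T \<in> K" using that c Y True by (auto simp: cells_def)
      then show ?thesis
        using polyhedral_complex_subset_face_of[OF complex, of T S] True
        by (simp add: primal.facets_def facet_incidence_def set_ordering)
    qed
    then have "{S \<in> c. T face_of S} = {S \<in> c. T \<in> primal.facets S}" by blast
    then show ?thesis using True by (simp add: bdry_def cells_def xsum_def)
  next
    case False
    have "xsum primal.facets c \<subseteq> cells K (p - 1)"
      using c primal.facets_subset_cells_of unfolding cells_eq by (intro xsum_subset) blast
    then show ?thesis using False by (auto simp: bdry_def cells_def)
  qed
qed

lemma bdry_complex_eq:
  assumes "c \<subseteq> cells K p"
  shows "bdry K p c = xsum primal.facets c"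
proof -
  have "xsum primal.facets c \<subseteq> K"
    using primal.facets_subset set_ordering by (intro xsum_subset) blast
  then show ?thesis using bdry_eq[OF subset_refl assms] by blast
qed

lemma cobdry_eq:
  assumes c: "c \<subseteq> cells K p"
  shows "cobdry K p c = xsum dual.facets c"
proof (rule Set.set_eqI)
  fix S
  show "S \<in> cobdry K p c \<longleftrightarrow> S \<in> xsum dual.facets c"
  proof (cases "S \<in> K \<and> aff_dim S = p + 1")
    case True
    have "T face_of S \<longleftrightarrow> S \<in> dual.facets T" if "T \<in> c" for T
    proof -
      have "T \<in> K" "aff_dim T = p" using that c by (auto simp: cells_def)
      then show ?thesis
        using polyhedral_complex_subset_face_of[OF complex, of T S] True
        unfolding dual.facets_def by (simp add: facet_incidence_def set_ordering)
    qed
    then have "{T \<in> c. T face_of S} = {T \<in> c. S \<in> dual.facets T}" by blast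
    then show ?thesis using True by (simp add: cobdry_def cells_def xsum_def)
  next
    case False
    have "dual.facets T \<subseteq> cells K (p + 1)" if "T \<in> c" for T
      using dual.facets_subset_cells_of[of T "- p"] that c unfolding cells_eq_dual by auto
    then have "xsum dual.facets c \<subseteq> cells K (p + 1)" by (rule xsum_subset)
    then show ?thesis using False by (auto simp: cobdry_def cells_def)
  qed
qed

lemma cycles_eq: "cycles K p = primal.cycs p"
  unfolding cycles_def primal.cycs_def cells_eq[symmetric] by (auto simp: bdry_complex_eq)

lemma cocycles_eq: "cocycles K p = dual.cycs (- p)"
  unfolding rel_cocycles_def dual.cycs_def cells_eq_dual[symmetric] by (auto simp: cobdry_eq)

text \<open>A prefix contains all facets of its cells, so a boundary taken in it loses nothing
  compared with the boundary in \<open>K\<close>.\<close>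

lemma boundaries_prefix_eq: "boundaries (set (take j \<sigma>)) (p - 1) = primal.chain_bnds p j"
proof -
  let ?Y = "set (take j \<sigma>)"
  have Y: "?Y \<subseteq> K" using set_take_subset set_ordering by fast
  have cY: "cells ?Y p = primal.cells_of p \<inter> ?Y"
    using Y unfolding cells_eq[symmetric] by (auto simp: cells_def)
  have "bdry ?Y p c = xsum primal.facets c" if "c \<in> Pow (cells ?Y p)" for c
  proof -
    have c: "c \<subseteq> cells K p" "c \<subseteq> ?Y" using that unfolding cY cells_eq by auto
    have "primal.facets s \<subseteq> ?Y" if "s \<in> c" for s
      using primal.prefix_facets_subset[OF append_take_drop_id[symmetric]] c(2) that by blast
    then have "xsum primal.facets c \<subseteq> ?Y" by (rule xsum_subset)
    then show ?thesis using bdry_eq[OF Y c(1)] by blast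
  qed
  then have "bdry ?Y p ` Pow (cells ?Y p) = xsum primal.facets ` Pow (cells ?Y p)"
    by (rule image_cong[OF refl])
  then show ?thesis by (simp add: boundaries_def primal.chain_bnds_def z2_span_def cY)
qed

lemma boundaries_eq: "boundaries K p = primal.bnds p"
proof -
  have "primal.cells_of (p + 1) \<inter> set \<sigma> = primal.cells_of (p + 1)" using primal.cells_of_subset by blast
  then show ?thesis
    using boundaries_prefix_eq[of "length \<sigma>" "p + 1"]
    by (simp add: set_ordering primal.chain_bnds_def primal.bnds_def)
qed

text \<open>The complement of the first \<open>i\<close> cells is the prefix of length
  \<open>length \<sigma> - i\<close> of the reversed list, and relative coboundaries are the
  boundaries of that dual subcomplex.\<close>

lemma rel_coboundaries_eq:
  assumes i: "i \<le> length \<sigma>"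
  shows "rel_coboundaries K (set (take i \<sigma>)) (p + 1) = dual.chain_bnds (- p) (length \<sigma> - i)"
proof -
  let ?Y = "K - set (take i \<sigma>)"
  have "set (take (length \<sigma> - i) (rev \<sigma>)) = set (drop i \<sigma>)" using i by (simp add: take_rev)
  moreover have "?Y = set (drop i \<sigma>)"
  proof -
    have "set \<sigma> = set (take i \<sigma>) \<union> set (drop i \<sigma>)" by (metis append_take_drop_id set_append)
    moreover have "set (take i \<sigma>) \<inter> set (drop i \<sigma>) = {}"
      using primal.distinct_cells by (simp add: set_take_disj_set_drop_if_distinct)
    ultimately show ?thesis using set_ordering by blast
  qed
  moreover have "cells ?Y p = cells K p \<inter> ?Y" by (auto simp: cells_def)
  ultimately have cY: "cells ?Y p = dual.cells_of (- p) \<inter> set (take (length \<sigma> - i) (rev \<sigma>))"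
    using cells_eq_dual by simp
  have "cobdry K p c = xsum dual.facets c" if "c \<in> Pow (cells ?Y p)" for c
    using that by (intro cobdry_eq) (auto simp: cells_def)
  then have "cobdry K p ` Pow (cells ?Y p) = xsum dual.facets ` Pow (cells ?Y p)"
    by (rule image_cong[OF refl])
  then show ?thesis by (simp add: rel_coboundaries_def dual.chain_bnds_def z2_span_def cY)
qed

lemma coboundaries_eq: "coboundaries K p = dual.bnds (- p)"
proof -
  have "dual.cells_of (1 - p) \<inter> set \<sigma> = dual.cells_of (1 - p)" using dual.cells_of_subset by auto
  then show ?thesis
    using rel_coboundaries_eq[of 0 "p - 1"]
    by (simp add: dual.chain_bnds_def dual.bnds_def algebra_simps)
qed

lemma cycle_group_eq: "cycle_group K p = z2_group (primal.cycs p)"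
  by (simp add: cycle_group_def chain_group_def z2_group_def cycles_eq)

lemma boundary_group_eq: "boundary_group K p = z2_group (primal.bnds p)"
  by (simp add: boundary_group_def chain_group_def z2_group_def boundaries_eq)

lemma cocycle_group_eq: "cocycle_group K p = z2_group (dual.cycs (- p))"
  by (simp add: cocycle_group_def chain_group_def z2_group_def cocycles_eq)

lemma coboundary_group_eq: "coboundary_group K p = z2_group (dual.bnds (- p))"
  by (simp add: coboundary_group_def chain_group_def z2_group_def coboundaries_eq)

lemma canonical_cycle_eq: "canonical_cycle \<sigma> p = primal.can_cycle p"
  by (rule ext) (simp add: canonical_cycle_def primal.can_cycle_def set_ordering cycles_eq primal.tri_lower_eq)

lemma canonical_cocycle_eq: "canonical_cocycle \<sigma> p = dual.can_cycle (- p)"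
  by (rule ext) (simp add: canonical_cocycle_def dual.can_cycle_def set_ordering cocycles_eq
      primal.tri_upper_eq primal.dual_lower)

lemma finprod_chain_group:
  assumes "S \<subseteq> cells K q" "\<And>s. s \<in> S \<Longrightarrow> f s \<subseteq> cells K p"
  shows "finprod (chain_group K p) f S = xsum f S"
proof -
  have "chain_group K p = z2_group (Pow (cells K p))" by (simp add: chain_group_def z2_group_def)
  moreover have "z2_subspace (Pow (cells K p))" by (auto simp: z2_subspace_def)
  moreover have "finite S" using assms(1) unfolding cells_eq by (rule primal.finite_subset_cells_of)
  ultimately show ?thesis using finprod_z2_group[of "Pow (cells K p)" S f] assms(2) by auto
qed

lemma tri_rest_prefix: "tri_rest (take j \<sigma>) p = filtered_complex.rest (take j \<sigma>) facet_incidence aff_dim p"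
  by (intro incidence_complex.tri_rest_eq incidence_complex.intro
      primal.prefix_complex[OF append_take_drop_id[symmetric]])

text \<open>\<open>tri_rest\<close> reduces the suffix in its own order, whereas the dual complex
  contains it reversed. Reversal only exchanges \<open>lower\<close> and \<open>upper\<close>, so
  \<open>rest\<close> is the same.\<close>

lemma tri_rest_suffix:
  assumes "i < length \<sigma>"
  shows "tri_rest (drop (Suc i) \<sigma>) p = filtered_complex.rest (take (length \<sigma> - Suc i) (rev \<sigma>))
     (\<lambda>t s. facet_incidence s t) (\<lambda>s. - aff_dim s) (- p)"
proof -
  have suf: "filtered_complex (drop (Suc i) \<sigma>) facet_incidence aff_dim"
    by (rule primal.suffix_complex[OF append_take_drop_id[symmetric]])
  have "take (length \<sigma> - Suc i) (rev \<sigma>) = rev (drop (Suc i) \<sigma>)" using assms by (simp add: take_rev)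
  then show ?thesis
    using incidence_complex.tri_rest_eq[OF incidence_complex.intro[OF suf], of p]
      filtered_complex.dual_rest[OF suf, of p] by simp
qed

lemma canonical_chain_eq: "canonical_chain \<sigma> p j = primal.can_chain p j"
proof -
  let ?rest = "filtered_complex.rest (take j \<sigma>) facet_incidence aff_dim (p - 1)"
  have rest: "finprod (chain_group K (p - 1)) (canonical_cycle \<sigma> (p - 1)) S = xsum (primal.can_cycle (p - 1)) S"
    if "S \<subseteq> ?rest" for S
    unfolding canonical_cycle_eq
  proof (rule finprod_chain_group)
    have S: "S \<subseteq> primal.cells_of (p - 1) - primal.lower (p - 1)"
      using that primal.prefix_rest_subset[OF append_take_drop_id[symmetric]] by blast
    then show "S \<subseteq> cells K (p - 1)" unfolding cells_eq by blast
    fix s assume "s \<in> S"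
    then show "primal.can_cycle (p - 1) s \<subseteq> cells K (p - 1)"
      using S primal.can_cycle(1) unfolding cells_eq primal.cycs_def by blast
  qed
  have bd: "bdry K p c = xsum primal.facets c" if "c \<subseteq> primal.lower p" for c
  proof (rule bdry_complex_eq)
    show "c \<subseteq> cells K p" unfolding cells_eq using that primal.lower_subset[of p] by blast
  qed
  show ?thesis
    unfolding canonical_chain_def primal.can_chain_def set_ordering primal.tri_lower_eq tri_rest_prefix
      boundaries_prefix_eq
    by (rule arg_cong[where f = The], rule ext, rule conj_cong[OF refl]) (simp add: bd rest cong: conj_cong)
qed

text \<open>The cell at position \<open>i\<close> has position
  \<open>length \<sigma> - Suc i\<close> in the reversed list. Passing from the pair with
  \<open>take (Suc i) \<sigma>\<close> to that with \<open>take i \<sigma>\<close> adds exactly this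
  cell to a prefix of the dual.\<close>

lemma canonical_cochain_eq:
  assumes i: "i < length \<sigma>"
  shows "canonical_cochain \<sigma> p i = dual.can_chain (- p) (length \<sigma> - Suc i)"
proof -
  let ?j = "length \<sigma> - Suc i"
  let ?rest = "filtered_complex.rest (take ?j (rev \<sigma>)) (\<lambda>t s. facet_incidence s t) (\<lambda>s. - aff_dim s) (- p - 1)"
  have neg: "- (p + 1) = - p - 1" by simp
  have rest: "finprod (chain_group K (p + 1)) (canonical_cocycle \<sigma> (p + 1)) S = xsum (dual.can_cycle (- p - 1)) S"
    if "S \<subseteq> ?rest" for S
    unfolding canonical_cocycle_eq neg
  proof (rule finprod_chain_group)
    have S: "S \<subseteq> dual.cells_of (- p - 1) - dual.lower (- p - 1)"
      using that dual.prefix_rest_subset[OF append_take_drop_id[symmetric]] by blast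
    then show "S \<subseteq> cells K (p + 1)" unfolding cells_eq_dual neg by blast
    fix s assume "s \<in> S"
    then show "dual.can_cycle (- p - 1) s \<subseteq> cells K (p + 1)"
      using S dual.can_cycle(1) unfolding cells_eq_dual neg dual.cycs_def by blast
  qed
  have bd: "cobdry K p c = xsum dual.facets c" if "c \<subseteq> dual.lower (- p)" for c
  proof (rule cobdry_eq)
    show "c \<subseteq> cells K p" unfolding cells_eq_dual using that dual.lower_subset[of "- p"] by blast
  qed
  have Suc: "length \<sigma> - i = Suc ?j" using i by simp
  have rel: "rel_coboundaries K (set (take (Suc i) \<sigma>)) (p + 1) = dual.chain_bnds (- p) ?j"
    "rel_coboundaries K (set (take i \<sigma>)) (p + 1) = dual.chain_bnds (- p) (Suc ?j)"
    using rel_coboundaries_eq[of "Suc i" p] rel_coboundaries_eq[of i p] i Suc by simp_all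
  show ?thesis
    unfolding canonical_cochain_def dual.can_chain_def set_ordering primal.tri_upper_eq
      primal.dual_lower[symmetric] tri_rest_suffix[OF i] rel neg
    by (rule arg_cong[where f = The], rule ext, rule conj_cong[OF refl]) (simp add: bd rest cong: conj_cong)
qed

lemma basis_boundaries:
  "z2_basis (boundary_group K (p - 1)) {j. j < length \<sigma> \<and> \<sigma> ! j \<in> tri_lower \<sigma> p}
     (\<lambda>j. bdry K p (canonical_chain \<sigma> p j))"
proof (rule z2_basis_reindex[OF primal.basis_bnds[of p, folded boundary_group_eq]])
  fix j assume j: "j \<in> {j. j < length \<sigma> \<and> \<sigma> ! j \<in> tri_lower \<sigma> p}"
  then have "canonical_chain \<sigma> p j \<subseteq> cells K p"
    using primal.can_chain(1)[of j p] primal.lower_subset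
    unfolding canonical_chain_eq primal.tri_lower_eq cells_eq by blast
  then show "bdry K p (canonical_chain \<sigma> p j) = xsum primal.facets (primal.can_chain p (id j))"
    by (simp add: bdry_complex_eq canonical_chain_eq)
qed (simp_all add: primal.tri_lower_eq)

text \<open>The dual basis is indexed by positions in the reversed list; the involution
  \<open>?r\<close> carries it back to positions in \<open>\<sigma>\<close>.\<close>

lemma basis_coboundaries:
  "z2_basis (coboundary_group K (p + 1)) {i. i < length \<sigma> \<and> \<sigma> ! i \<in> tri_upper \<sigma> p}
     (\<lambda>i. cobdry K p (canonical_cochain \<sigma> p i))"
proof -
  let ?n = "length \<sigma>" and ?r = "\<lambda>i. length \<sigma> - Suc i"
  let ?I = "{i. i < ?n \<and> \<sigma> ! i \<in> tri_upper \<sigma> p}" and ?J = "{j. j < length (rev \<sigma>) \<and> rev \<sigma> ! j \<in> dual.lower (- p)}"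
  have nth: "rev \<sigma> ! ?r i = \<sigma> ! i" if "i < ?n" for i
    using that by (subst rev_nth) auto
  have r: "?r i \<in> ?J" if "i \<in> ?I" for i
    using that nth[of i] diff_less[of "Suc i" ?n] by (auto simp: primal.tri_upper_eq primal.dual_lower)
  have r': "?r j \<in> ?I" "?r (?r j) = j" if "j \<in> ?J" for j
    using that rev_nth[of j \<sigma>] diff_less[of "Suc j" ?n] by (auto simp: primal.tri_upper_eq primal.dual_lower)
  have "?r ` ?I = ?J"
  proof
    show "?J \<subseteq> ?r ` ?I"
    proof
      fix j assume "j \<in> ?J"
      then show "j \<in> ?r ` ?I" using r' by (metis (no_types, lifting) image_eqI)
    qed
  qed (use r in blast)
  moreover have "inj_on ?r ?I" by (auto simp: inj_on_def)
  moreover have "cobdry K p (canonical_cochain \<sigma> p i) = xsum dual.facets (dual.can_chain (- p) (?r i))"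
    if "i \<in> ?I" for i
  proof -
    have i: "i < ?n" using that by simp
    have "dual.can_chain (- p) (?r i) \<subseteq> cells K p"
      using dual.can_chain(1)[of "?r i" "- p"] dual.lower_subset r[OF that]
      unfolding cells_eq_dual by blast
    then show ?thesis by (simp add: cobdry_eq canonical_cochain_eq[OF i])
  qed
  moreover have "- p - 1 = - (p + 1)" by simp
  ultimately show ?thesis
    using z2_basis_reindex[OF dual.basis_bnds[of "- p"], of ?r ?I "\<lambda>i. cobdry K p (canonical_cochain \<sigma> p i)"]
    unfolding coboundary_group_eq by simp
qed

end

theorem theorem2:
  fixes K :: "'a::euclidean_space set set" and \<sigma> :: "'a set list" and p :: int
  assumes "polyhedral_complex K" and "monotonic_ordering K \<sigma>"
  shows
    "z2_basis (cycle_group K p) (tri_upper \<sigma> p \<union> tri_rest \<sigma> p) (canonical_cycle \<sigma> p) \<and>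
     z2_basis (homology K p) (tri_rest \<sigma> p)
       (\<lambda>s. homology_class K p (canonical_cycle \<sigma> p s)) \<and>
     z2_basis (boundary_group K (p - 1)) {j. j < length \<sigma> \<and> \<sigma> ! j \<in> tri_lower \<sigma> p}
       (\<lambda>j. bdry K p (canonical_chain \<sigma> p j)) \<and>
     z2_basis (cocycle_group K p) (tri_lower \<sigma> p \<union> tri_rest \<sigma> p) (canonical_cocycle \<sigma> p) \<and>
     z2_basis (cohomology K p) (tri_rest \<sigma> p)
       (\<lambda>s. cohomology_class K p (canonical_cocycle \<sigma> p s)) \<and>
     z2_basis (coboundary_group K (p + 1)) {i. i < length \<sigma> \<and> \<sigma> ! i \<in> tri_upper \<sigma> p}
       (\<lambda>i. cobdry K p (canonical_cochain \<sigma> p i))"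
proof -
  interpret ordered_polyhedral_complex K \<sigma>
    using assms by (rule ordered_polyhedral_complex.intro)
  note tri = primal.tri_lower_eq primal.tri_upper_eq primal.tri_rest_eq
  have "z2_basis (cycle_group K p) (tri_upper \<sigma> p \<union> tri_rest \<sigma> p) (canonical_cycle \<sigma> p)"
    unfolding tri cycle_group_eq canonical_cycle_eq by (rule primal.basis_cycs)
  moreover have "z2_basis (homology K p) (tri_rest \<sigma> p) (\<lambda>s. homology_class K p (canonical_cycle \<sigma> p s))"
    unfolding tri homology_def homology_class_def cycle_group_eq canonical_cycle_eq boundaries_eq
    by (rule primal.basis_homology)
  \<comment> \<open>The dual \<open>upper\<close> is the primal \<open>lower\<close>, while
    \<open>rest\<close> is self-dual; this produces the index set for cocycles.\<close>
  moreover have "z2_basis (cocycle_group K p) (tri_lower \<sigma> p \<union> tri_rest \<sigma> p) (canonical_cocycle \<sigma> p)"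
    unfolding tri cocycle_group_eq canonical_cocycle_eq
    using dual.basis_cycs[of "- p"] by (simp add: primal.dual_upper primal.dual_rest)
  moreover have "z2_basis (cohomology K p) (tri_rest \<sigma> p) (\<lambda>s. cohomology_class K p (canonical_cocycle \<sigma> p s))"
    unfolding tri cohomology_def cohomology_class_def cocycle_group_eq canonical_cocycle_eq coboundaries_eq
    using dual.basis_homology[of "- p"] by (simp add: primal.dual_rest)
  ultimately show ?thesis using basis_boundaries basis_coboundaries by blast
qed

end
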